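(* Let $0<T\le\infty$ and let $\{X(t):0\le t<T\}$ be a zero-mean Gaussian process of dimension $m\times1$ with covariance kernel $$\Gamma(t,s)=\begin{cases} s(\alpha-\beta t), & 0\le s\le t<T,\\ t(\alpha-\beta s), & 0\le t<s<T,\end{cases}$$ where $\alpha,\beta$ are real symmetric $m\times m$ matrices. If $X(u)$ is given for some $0<u<T$, then $\{X(t):0\le t\le u\}$ is conditionally (given $X(u)$) a Gaussian process with $$E[X(t)\mid X(u)]=tu^{-1}X(u)\quad\text{for }0\le t\le u$$ and $$E\big[(X(t)-E[X(t)\mid X(u)])(X(s)-E[X(s)\mid X(u)])^T\,\big|\,X(u)\big]=\begin{cases}(I-tu^{-1}I)\,s\alpha, & 0\le s\le t\le u,\\ t\alpha\,(I-su^{-1}I), & 0\le t<s\le u.\end{cases}$$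
   Context: $\Gamma(t,s)=E[X(t)X^T(s)]$ and $I$ is the $m\times m$ identity matrix. *)

theory Defs
  imports "HOL-Probability.Probability"
begin

text \<open>
  Normal law on the line with mean \<open>\<mu>\<close> and standard deviation \<open>\<sigma> \<ge> 0\<close>. The degenerate case
  must be included separately, because \<open>normal_density \<mu> 0\<close> is the zero function, and it
  does occur: covariance matrices may be singular.
\<close>
definition normal_law :: "real \<Rightarrow> real \<Rightarrow> real measure" where
  "normal_law \<mu> \<sigma> =
     (if \<sigma> = 0 then return borel \<mu> else density lborel (\<lambda>x. ennreal (normal_density \<mu> \<sigma> x)))"

text \<open>
  The finite family \<open>(Y j)\<^sub>j\<^sub>\<in>\<^sub>J\<close> of random vectors has a (possibly singular) multivariate normal
  joint distribution: every linear combination of all the scalar components is normal.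
\<close>
definition jointly_normal :: "'a measure \<Rightarrow> 'i set \<Rightarrow> ('i \<Rightarrow> 'a \<Rightarrow> real ^ 'm) \<Rightarrow> bool" where
  "jointly_normal M J Y \<longleftrightarrow>
     (\<forall>c :: 'i \<Rightarrow> real ^ 'm. \<exists>\<mu> \<sigma>. \<sigma> \<ge> 0 \<and>
        distr M borel (\<lambda>\<omega>. \<Sum>j\<in>J. c j \<bullet> Y j \<omega>) = normal_law \<mu> \<sigma>)"

definition gaussian_process :: "'a measure \<Rightarrow> 'i set \<Rightarrow> ('i \<Rightarrow> 'a \<Rightarrow> real ^ 'm) \<Rightarrow> bool" where
  "gaussian_process M I X \<longleftrightarrow>
     (\<forall>t\<in>I. X t \<in> borel_measurable M) \<and>
     (\<forall>J. finite J \<and> J \<subseteq> I \<longrightarrow> jointly_normal M J X)"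

definition sigma_gen :: "'a measure \<Rightarrow> ('a \<Rightarrow> real ^ 'k) \<Rightarrow> 'a measure" where
  "sigma_gen M Z = vimage_algebra (space M) Z borel"

text \<open>
  \<open>K\<close> is a regular conditional distribution of the \<open>N\<close>-valued random element \<open>Y\<close> given \<open>Z\<close>:
  a probability kernel such that \<open>K (Z \<omega>) A\<close> is a version of the conditional probability
  of \<open>Y \<in> A\<close> given \<open>Z\<close>, for every measurable \<open>A\<close>.
\<close>
definition regular_cond_distr ::
  "'a measure \<Rightarrow> 'b measure \<Rightarrow> ('a \<Rightarrow> 'b) \<Rightarrow> ('a \<Rightarrow> real ^ 'k) \<Rightarrow> (real ^ 'k \<Rightarrow> 'b measure) \<Rightarrow> bool"
where
  "regular_cond_distr M N Y Z K \<longleftrightarrow>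
     Y \<in> M \<rightarrow>\<^sub>M N \<and> Z \<in> borel_measurable M \<and> K \<in> borel \<rightarrow>\<^sub>M prob_algebra N \<and>
     (\<forall>A\<in>sets N. AE \<omega> in M.
        measure (K (Z \<omega>)) A =
        real_cond_exp M (sigma_gen M Z) (indicator (Y -` A \<inter> space M)) \<omega>)"

text \<open>
  The process \<open>(X t)\<^sub>t\<^sub>\<in>\<^sub>I\<close>, viewed as a random element of the product space over \<open>I\<close>, has a regular
  conditional distribution given \<open>Z\<close> under which, for almost every value of \<open>Z\<close>, the
  coordinate process is Gaussian.
\<close>
definition cond_gaussian_process ::
  "'a measure \<Rightarrow> 'i set \<Rightarrow> ('i \<Rightarrow> 'a \<Rightarrow> real ^ 'm) \<Rightarrow> ('a \<Rightarrow> real ^ 'k) \<Rightarrow> bool" where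
  "cond_gaussian_process M I X Z \<longleftrightarrow>
     (\<exists>K. regular_cond_distr M (Pi\<^sub>M I (\<lambda>_. borel)) (\<lambda>\<omega>. \<lambda>t\<in>I. X t \<omega>) Z K \<and>
          (AE z in distr M borel Z. gaussian_process (K z) I (\<lambda>t x. x t)))"

definition vec_cond_exp :: "'a measure \<Rightarrow> 'a measure \<Rightarrow> ('a \<Rightarrow> real ^ 'n) \<Rightarrow> 'a \<Rightarrow> real ^ 'n" where
  "vec_cond_exp M F Y \<omega> = (\<chi> i. real_cond_exp M F (\<lambda>\<omega>. Y \<omega> $ i) \<omega>)"

definition mat_cond_exp ::
  "'a measure \<Rightarrow> 'a measure \<Rightarrow> ('a \<Rightarrow> real ^ 'n ^ 'm) \<Rightarrow> 'a \<Rightarrow> real ^ 'n ^ 'm" where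
  "mat_cond_exp M F Y \<omega> = (\<chi> i j. real_cond_exp M F (\<lambda>\<omega>. Y \<omega> $ i $ j) \<omega>)"

text \<open>The matrix \<open>x y\<^sup>T\<close>.\<close>
definition outer_prod :: "real ^ 'm \<Rightarrow> real ^ 'n \<Rightarrow> real ^ 'n ^ 'm" where
  "outer_prod x y = (columnvector x :: real ^ 1 ^ 'm) ** (rowvector y :: real ^ 'n ^ 1)"

text \<open>Covariance kernel \<open>E[X(t) X(s)\<^sup>T]\<close> of a zero-mean process.\<close>
definition cov_kernel :: "'a measure \<Rightarrow> (real \<Rightarrow> 'a \<Rightarrow> real ^ 'm) \<Rightarrow> real \<Rightarrow> real \<Rightarrow> real ^ 'm ^ 'm" where
  "cov_kernel M X t s = integral\<^sup>L M (\<lambda>\<omega>. outer_prod (X t \<omega>) (X s \<omega>))"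

end

theory Submission
  imports Defs
begin

text \<open>
  Put \<open>W t = X t - (t/u) X u\<close> for \<open>0 \<le> t \<le> u\<close>. The kernel \<open>\<Gamma>\<close> gives
  \<open>\<Gamma>(t,u) = (t/u) \<Gamma>(u,u)\<close>, so every \<open>W t\<close> is uncorrelated with \<open>X u\<close>, and hence the whole process
  \<open>W\<close> is independent of \<open>X u\<close>. Consequently the conditional law of \<open>X\<close> given \<open>X u = z\<close> is the
  law of \<open>t \<mapsto> W t + (t/u) z\<close>: it is Gaussian, has mean \<open>(t/u) z\<close>, and its covariance is that
  of \<open>W\<close>.

  The step from uncorrelated to independent needs a multivariate uniqueness theorem for
  characteristic functions, which is reduced here to the one on the line, one coordinate at a time.
\<close>

section \<open>Uniqueness of multivariate characteristic functions\<close>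

text \<open>The covariance matrix \<open>\<Gamma>(u,u)\<close> may be singular, so neither a
  conditional density nor the usual regression coefficient, \<open>\<Gamma>(t,u)\<close> times the
  inverse of \<open>\<Gamma>(u,u)\<close>, is available. The kernel offers a substitute: for t <= u
  one has \<Gamma>(t,u) = t(\<alpha> - \<beta> u), whose matrix factor does not depend on t, so the
  scalar t/u does the work of that coefficient. The same factor makes \<beta> cancel in the
  covariance of W: for s <= t, s(\<alpha> - \<beta> t) - (s/u) t(\<alpha> - \<beta> u) = s(1 - t/u)
  \<alpha>. Singular covariances are also why joint normality speaks of linear combinations. What it
  controls directly is the integral of \<open>iexp\<close> of such a combination, hence the detour
  through characteristic functions. Independence concerns a process with uncountable index set; it
  is an equality of laws on product spaces and can be tested on finitely many coordinates at a time.
  Once it is known, the regular conditional distribution is written down explicitly instead of being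
  obtained from an existence theorem.\<close>

lemma finite_measure_char_unique:
  fixes P Q :: "real measure"
  assumes "finite_measure P" "finite_measure Q"
    and [measurable_cong, simp]: "sets P = sets borel" "sets Q = sets borel"
    and char: "\<And>t. char P t = char Q t"
  shows "P = Q"
proof -
  interpret P: finite_measure P by fact
  interpret Q: finite_measure Q by fact
  have [simp]: "space P = UNIV" "space Q = UNIV"
    using sets_eq_imp_space_eq[of P borel] sets_eq_imp_space_eq[of Q borel] by auto
  \<comment> \<open>The characteristic function at 0 is the total mass, so both measures have mass
    \<open>m\<close>. Dividing by \<open>m\<close> gives probability measures, to which
    \<open>Levy_uniqueness\<close> applies; if \<open>m = 0\<close>, both are the zero
    measure.\<close>
  define m where "m = measure P UNIV"
  have m: "measure Q UNIV = m"
    using char[of 0] by (simp add: char_def m_def)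
  show ?thesis
  proof (cases "m = 0")
    case True
    have "emeasure P A = emeasure Q A" for A
    proof -
      have "measure P A \<le> measure P UNIV" "measure Q A \<le> measure Q UNIV"
        using P.bounded_measure[of A] Q.bounded_measure[of A] by auto
      then have "measure P A = 0" "measure Q A = 0"
        using m True by (auto simp: m_def measure_le_0_iff)
      then show ?thesis
        by (simp add: P.emeasure_eq_measure Q.emeasure_eq_measure)
    qed
    then show ?thesis by (intro measure_eqI) auto
  next
    case False
    then have mpos: "m > 0" by (simp add: m_def zero_less_measure_iff)
    let ?D = "\<lambda>R. density R (\<lambda>_. ennreal (1 / m))"
    have emeasure_D: "emeasure (?D R) A = ennreal (1 / m) * emeasure R A"
      if "sets R = sets borel" "A \<in> sets borel" for R :: "real measure" and A
      using that by (simp add: emeasure_density nn_integral_cmult_indicator)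
    have real: "real_distribution (?D R)" if "finite_measure R" "sets R = sets borel" "measure R UNIV = m"
      for R :: "real measure"
    proof -
      interpret R: finite_measure R by fact
      have [simp]: "space R = UNIV" using sets_eq_imp_space_eq[OF that(2)] by simp
      have "emeasure (?D R) (space (?D R)) = 1"
        using that mpos by (simp add: emeasure_D R.emeasure_eq_measure flip: ennreal_mult')
      then show ?thesis
        using that by (auto simp: real_distribution_def real_distribution_axioms_def intro: prob_spaceI)
    qed
    have "char (?D P) = char (?D Q)"
    proof
      fix t show "char (?D P) t = char (?D Q) t"
        using char[of t] mpos unfolding char_def by (subst (1 2) integral_density) auto
    qed
    then have D: "?D P = ?D Q"
      using m by (intro Levy_uniqueness real assms) (auto simp: m_def)
    show ?thesis
    proof (rule measure_eqI)
      fix A assume "A \<in> sets P"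
      then have "ennreal (1 / m) * emeasure P A = ennreal (1 / m) * emeasure Q A"
        using arg_cong[OF D, of "\<lambda>R. emeasure R A"] by (simp add: emeasure_D)
      then show "emeasure P A = emeasure Q A"
        using mpos by (subst (asm) ennreal_mult_cancel_left) auto
    qed simp
  qed
qed

lemma integrable_scaleR_iexp:
  assumes "finite_measure P" and [measurable]: "h \<in> borel_measurable P" "V \<in> borel_measurable P"
    and "\<And>x. \<bar>h x\<bar> \<le> (b :: real)"
  shows "integrable P (\<lambda>x. h x *\<^sub>R iexp (V x))"
proof -
  interpret finite_measure P by fact
  show ?thesis
    using assms(4) by (intro integrable_const_bound[of _ b]) auto
qed

text \<open>Euler's formula spreads the weight over the three frequencies x, x + y and x - y. The
  characteristic function of a tilted measure thereby becomes a combination of integrals that are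
  already known to agree.\<close>

lemma iexp_times_one_plus_cos:
  "(1 + cos (y - \<phi>)) *\<^sub>R iexp x =
     iexp x + (iexp (- \<phi>) / 2) * iexp (x + y) + (iexp \<phi> / 2) * iexp (x - y)"
proof -
  have "complex_of_real (cos (y - \<phi>)) = (iexp (y - \<phi>) + iexp (- (y - \<phi>))) / 2"
    unfolding cos_of_real[symmetric] cos_exp_eq by (simp add: algebra_simps)
  then have "(1 + cos (y - \<phi>)) *\<^sub>R iexp x
      = iexp x + (iexp (y - \<phi>) * iexp x) / 2 + (iexp (- (y - \<phi>)) * iexp x) / 2"
    by (simp add: scaleR_conv_of_real distrib_right add_divide_distrib)
  then show ?thesis
    by (simp add: mult_exp_exp algebra_simps)
qed

text \<open>
  A complex weight \<open>iexp \<theta>\<close> is not a density, but \<open>1 + cos (\<theta> - \<phi>)\<close> is one, so the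
  one-dimensional uniqueness theorem can be applied to the tilted measures; the phases
  \<open>\<phi> = 0, \<pi> / 2\<close> recover real and imaginary parts.
\<close>
lemma iexp_weight_indicator_eq:
  fixes V h \<theta> :: "'a \<Rightarrow> real"
  assumes "finite_measure P" "finite_measure Q" and [measurable_cong]: "sets P = sets Q"
    and [measurable]: "V \<in> borel_measurable Q" "h \<in> borel_measurable Q" "\<theta> \<in> borel_measurable Q"
      "A \<in> sets borel"
    and h: "\<And>x. 0 \<le> h x" "\<And>x. h x \<le> 1"
    and eq: "\<And>c e. (\<integral>x. h x *\<^sub>R iexp (c * V x + e * \<theta> x) \<partial>P) = (\<integral>x. h x *\<^sub>R iexp (c * V x + e * \<theta> x) \<partial>Q)"
  shows "(\<integral>x. (h x * indicator A (V x)) *\<^sub>R iexp (\<theta> x) \<partial>P) = (\<integral>x. (h x * indicator A (V x)) *\<^sub>R iexp (\<theta> x) \<partial>Q)"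
proof -
  interpret P: finite_measure P by fact
  interpret Q: finite_measure Q by fact
  \<comment> \<open>Weight both measures by \<open>h * (1 + cos (e * \<theta> - \<phi>))\<close> and
    push them forward along \<open>V\<close>. The characteristic functions of the two images at
    \<open>t\<close> are built from the integrals in \<open>eq\<close> for the pairs (t, 0), (t, e)
    and (t, -e), so the images coincide and give \<open>A\<close> the same mass.\<close>
  have tilt: "(\<integral>x. h x * (1 + cos (e * \<theta> x - \<phi>)) * indicator A (V x) \<partial>P)
      = (\<integral>x. h x * (1 + cos (e * \<theta> x - \<phi>)) * indicator A (V x) \<partial>Q)" for \<phi> e
  proof -
    let ?w = "\<lambda>x. h x * (1 + cos (e * \<theta> x - \<phi>))"
    let ?D = "\<lambda>R. distr (density R (\<lambda>x. ennreal (?w x))) borel V"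
    have w: "0 \<le> ?w x" "?w x \<le> 2" for x
    proof -
      have c: "0 \<le> 1 + cos (e * \<theta> x - \<phi>)" "1 + cos (e * \<theta> x - \<phi>) \<le> 2"
        using cos_ge_minus_one[of "e * \<theta> x - \<phi>"] cos_le_one[of "e * \<theta> x - \<phi>"] by linarith+
      show "0 \<le> ?w x" using c h[of x] by simp
      show "?w x \<le> 2" using c h[of x] mult_mono[of "h x" 1 "1 + cos (e * \<theta> x - \<phi>)" 2] by simp
    qed
    have fin: "finite_measure (?D R)" if "finite_measure R" and s: "sets R = sets Q" for R
    proof -
      interpret R: finite_measure R by fact
      note [measurable_cong] = s
      have "integrable R ?w"
        using w by (intro R.integrable_const_bound[of _ 2]) auto
      then have "finite_measure (density R (\<lambda>x. ennreal (?w x)))"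
        using w by (intro finite_measureI) (simp add: emeasure_density nn_integral_eq_integral)
      then show ?thesis
        by (intro finite_measure.finite_measure_distr) auto
    qed
    have ch: "char (?D R) t = (\<integral>x. h x *\<^sub>R iexp (t * V x + 0 * \<theta> x) \<partial>R)
        + (iexp (- \<phi>) / 2) * (\<integral>x. h x *\<^sub>R iexp (t * V x + e * \<theta> x) \<partial>R)
        + (iexp \<phi> / 2) * (\<integral>x. h x *\<^sub>R iexp (t * V x + (- e) * \<theta> x) \<partial>R)"
      if "finite_measure R" and s: "sets R = sets Q" for R t
    proof -
      note [measurable_cong] = s
      have int: "integrable R (\<lambda>x. h x *\<^sub>R iexp (t * V x + e * \<theta> x))" for e
        using h by (intro integrable_scaleR_iexp[where b=1] that) auto
      have "char (?D R) t = (\<integral>x. ?w x *\<^sub>R iexp (t * V x) \<partial>R)"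
        unfolding char_def using w by (simp add: integral_distr integral_density)
      also have "\<dots> = (\<integral>x. h x *\<^sub>R iexp (t * V x + 0 * \<theta> x)
          + (iexp (- \<phi>) / 2) * (h x *\<^sub>R iexp (t * V x + e * \<theta> x))
          + (iexp \<phi> / 2) * (h x *\<^sub>R iexp (t * V x + (- e) * \<theta> x)) \<partial>R)"
        by (intro Bochner_Integration.integral_cong refl)
           (unfold scaleR_scaleR[symmetric] iexp_times_one_plus_cos, simp add: scaleR_add_right)
      also have "\<dots> = (\<integral>x. h x *\<^sub>R iexp (t * V x + 0 * \<theta> x) \<partial>R)
          + (\<integral>x. (iexp (- \<phi>) / 2) * (h x *\<^sub>R iexp (t * V x + e * \<theta> x)) \<partial>R)
          + (\<integral>x. (iexp \<phi> / 2) * (h x *\<^sub>R iexp (t * V x + (- e) * \<theta> x)) \<partial>R)"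
        by (intro trans[OF Bochner_Integration.integral_add] arg_cong2[where f="(+)"] refl
            Bochner_Integration.integral_add Bochner_Integration.integrable_add integrable_mult_right int)
      finally show ?thesis by (simp only: integral_mult_right_zero)
    qed
    have "?D P = ?D Q"
    proof (intro finite_measure_char_unique fin)
      fix t show "char (?D P) t = char (?D Q) t"
        by (simp only: ch[OF assms(1,3)] ch[OF assms(2) refl] eq)
    qed (use assms in simp_all)
    moreover have "(\<integral>v. (indicator A v :: real) \<partial>?D R) = (\<integral>x. ?w x * indicator A (V x) \<partial>R)"
      if s: "sets R = sets Q" for R
    proof -
      note [measurable_cong] = s
      show ?thesis
        using w by (subst integral_distr) (auto simp: integral_density)
    qed
    ultimately show ?thesis
      using assms(3) by (metis (no_types, lifting))
  qed
  have bnd: "\<bar>h x * y * indicator A (V x)\<bar> \<le> 1" if "\<bar>y\<bar> \<le> 1" for x y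
    using h[of x] that mult_mono[of "h x" 1 "\<bar>y\<bar>" 1] by (simp add: abs_mult indicator_def)
  have cosint: "integrable R (\<lambda>x. h x * cos (e * \<theta> x - \<phi>) * indicator A (V x))"
    if "finite_measure R" "sets R = sets Q" for R e \<phi>
  proof -
    interpret R: finite_measure R by fact
    note [measurable_cong] = that(2)
    show ?thesis
      using bnd by (intro R.integrable_const_bound[of _ 1]) auto
  qed
  have hint: "integrable R (\<lambda>x. h x * indicator A (V x))"
    if "finite_measure R" "sets R = sets Q" for R
    using cosint[OF that, of 0 0] by simp
  \<comment> \<open>For \<open>e = 0\<close> and \<open>\<phi> = pi / 2\<close> the cosine is 0 and
    the weight is \<open>h\<close> alone; subtracting this case from \<open>tilt\<close> isolates
    the cosine integral.\<close>
  have h_eq: "(\<integral>x. h x * indicator A (V x) \<partial>P) = (\<integral>x. h x * indicator A (V x) \<partial>Q)"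
    using tilt[of 0 "pi/2"] by simp
  have cos_eq: "(\<integral>x. h x * cos (e * \<theta> x - \<phi>) * indicator A (V x) \<partial>P)
      = (\<integral>x. h x * cos (e * \<theta> x - \<phi>) * indicator A (V x) \<partial>Q)" for e \<phi>
    using tilt[of e \<phi>] h_eq cosint[of P e \<phi>] cosint[of Q e \<phi>] hint[of P] hint[of Q] assms
    by (simp add: distrib_left distrib_right)
  have split: "(\<integral>x. (h x * indicator A (V x)) *\<^sub>R iexp (\<theta> x) \<partial>R)
      = of_real (\<integral>x. h x * cos (1 * \<theta> x - 0) * indicator A (V x) \<partial>R)
        + \<i> * of_real (\<integral>x. h x * cos (1 * \<theta> x - pi/2) * indicator A (V x) \<partial>R)"
    if "finite_measure R" "sets R = sets Q" for R
  proof -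
    have "(\<integral>x. (h x * indicator A (V x)) *\<^sub>R iexp (\<theta> x) \<partial>R)
      = (\<integral>x. of_real (h x * cos (1 * \<theta> x - 0) * indicator A (V x))
           + \<i> * of_real (h x * cos (1 * \<theta> x - pi/2) * indicator A (V x)) \<partial>R)"
      by (intro Bochner_Integration.integral_cong refl)
         (auto simp: complex_eq_iff Re_exp Im_exp cos_diff)
    also have "\<dots> = of_real (\<integral>x. h x * cos (1 * \<theta> x - 0) * indicator A (V x) \<partial>R)
        + \<i> * of_real (\<integral>x. h x * cos (1 * \<theta> x - pi/2) * indicator A (V x) \<partial>R)"
      using cosint[OF that, of 1 0] cosint[OF that, of 1 "pi/2"]
      by (subst Bochner_Integration.integral_add)
         (auto simp del: of_real_mult simp: integral_complex_of_real 
           intro!: integrable_mult_right integrable_of_real)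
    finally show ?thesis .
  qed
  show ?thesis
    using assms by (simp only: split cos_eq)
qed

text \<open>Exponentials are traded for indicators one coordinate at a time. In the induction,
  coordinates in \<open>S\<close> already carry their indicator and those in \<open>J - S\<close>
  still carry a phase: \<open>S = {}\<close> is the hypothesis, \<open>S = J\<close> the claim about
  boxes. The step for \<open>k\<close> uses \<open>V k\<close> as the real variable, the product of
  the indicators over \<open>S\<close> as \<open>h\<close>, and the remaining phase as
  \<open>\<theta>\<close>.\<close>

lemma box_measure_eq_of_iexp_integrals:
  fixes V :: "'j \<Rightarrow> 'a \<Rightarrow> real"
  assumes P: "finite_measure P" and Q: "finite_measure Q" and [measurable_cong]: "sets P = sets Q"
    and "finite J"
    and V[measurable]: "\<And>j. j \<in> J \<Longrightarrow> V j \<in> borel_measurable Q"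
    and A[measurable]: "\<And>j. j \<in> J \<Longrightarrow> A j \<in> sets borel"
    and eq: "\<And>d. (\<integral>x. iexp (\<Sum>j\<in>J. d j * V j x) \<partial>P) = (\<integral>x. iexp (\<Sum>j\<in>J. d j * V j x) \<partial>Q)"
  shows "measure P {x\<in>space P. \<forall>j\<in>J. V j x \<in> A j} = measure Q {x\<in>space Q. \<forall>j\<in>J. V j x \<in> A j}"
proof -
  interpret P: finite_measure P by fact
  interpret Q: finite_measure Q by fact
  note fin = \<open>finite J\<close>
  let ?h = "\<lambda>S x. \<Prod>j\<in>S. indicator (A j) (V j x) :: real"
  have hb: "0 \<le> ?h S x" "?h S x \<le> 1" for S x
    by (auto intro!: prod_nonneg prod_le_1)
  have "\<forall>d. (\<integral>x. ?h S x *\<^sub>R iexp (\<Sum>j\<in>J - S. d j * V j x) \<partial>P)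
      = (\<integral>x. ?h S x *\<^sub>R iexp (\<Sum>j\<in>J - S. d j * V j x) \<partial>Q)" if "S \<subseteq> J" for S
    using finite_subset[OF that fin] that
  proof (induction S rule: finite_induct)
    case empty
    then show ?case using eq by simp
  next
    case (insert k S)
    show ?case
    proof
      fix d :: "'j \<Rightarrow> real"
      have k[simp]: "k \<in> J" and SJ: "\<And>j. j \<in> S \<Longrightarrow> j \<in> J" using insert by auto
      have IH: "\<forall>d. (\<integral>x. ?h S x *\<^sub>R iexp (\<Sum>j\<in>J - S. d j * V j x) \<partial>P)
          = (\<integral>x. ?h S x *\<^sub>R iexp (\<Sum>j\<in>J - S. d j * V j x) \<partial>Q)"
        using insert.IH insert.prems by blast
      have hS: "?h S \<in> borel_measurable Q"
        using SJ by (intro borel_measurable_prod) auto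
      have th: "(\<lambda>x. \<Sum>j\<in>J - insert k S. d j * V j x) \<in> borel_measurable Q"
        by (intro borel_measurable_sum) auto
      \<comment> \<open>The two-parameter phase demanded by \<open>iexp_weight_indicator_eq\<close>
        is a phase over \<open>J - S\<close> with coefficient \<open>c\<close> at \<open>k\<close>
        and \<open>e * d j\<close> elsewhere. This is why the induction hypothesis has to hold for
        all coefficient families.\<close>
      have *: "(\<Sum>j\<in>J - S. (if j = k then c else e * d j) * V j x)
         = c * V k x + e * (\<Sum>j\<in>J - insert k S. d j * V j x)" for c e x
      proof -
        have "J - S = insert k (J - insert k S)" using insert by auto
        moreover have "(\<Sum>j\<in>insert k (J - insert k S). (if j = k then c else e * d j) * V j x)
           = c * V k x + (\<Sum>j\<in>J - insert k S. (if j = k then c else e * d j) * V j x)"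
          using fin by simp
        ultimately have "(\<Sum>j\<in>J - S. (if j = k then c else e * d j) * V j x)
           = c * V k x + (\<Sum>j\<in>J - insert k S. (if j = k then c else e * d j) * V j x)"
          by (simp only:)
        also have "(\<Sum>j\<in>J - insert k S. (if j = k then c else e * d j) * V j x)
            = e * (\<Sum>j\<in>J - insert k S. d j * V j x)"
          unfolding sum_distrib_left by (intro sum.cong) auto
        finally show ?thesis .
      qed
      have "(\<integral>x. (?h S x * indicator (A k) (V k x)) *\<^sub>R iexp (\<Sum>j\<in>J - insert k S. d j * V j x) \<partial>P)
          = (\<integral>x. (?h S x * indicator (A k) (V k x)) *\<^sub>R iexp (\<Sum>j\<in>J - insert k S. d j * V j x) \<partial>Q)"
      proof (rule iexp_weight_indicator_eq[OF P Q assms(3)])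
        fix c e :: real
        show "(\<integral>x. ?h S x *\<^sub>R iexp (c * V k x + e * (\<Sum>j\<in>J - insert k S. d j * V j x)) \<partial>P)
          = (\<integral>x. ?h S x *\<^sub>R iexp (c * V k x + e * (\<Sum>j\<in>J - insert k S. d j * V j x)) \<partial>Q)"
          unfolding *[symmetric] using IH by (rule spec)
        show "(\<lambda>x. \<Sum>j\<in>J - insert k S. d j * V j x) \<in> borel_measurable Q" by (rule th)
        show "?h S \<in> borel_measurable Q" by (rule hS)
        show "V k \<in> borel_measurable Q" "A k \<in> sets borel" using V A k by blast+
      qed (rule hb)+
      then show "(\<integral>x. ?h (insert k S) x *\<^sub>R iexp (\<Sum>j\<in>J - insert k S. d j * V j x) \<partial>P)
          = (\<integral>x. ?h (insert k S) x *\<^sub>R iexp (\<Sum>j\<in>J - insert k S. d j * V j x) \<partial>Q)"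
        using insert by (simp add: mult.commute)
    qed
  qed
  from this[OF order_refl] have J: "(\<integral>x. ?h J x *\<^sub>R (1::complex) \<partial>P) = (\<integral>x. ?h J x *\<^sub>R (1::complex) \<partial>Q)"
    by simp
  have "of_real (measure R {x\<in>space R. \<forall>j\<in>J. V j x \<in> A j}) = (\<integral>x. ?h J x *\<^sub>R (1::complex) \<partial>R)"
    if "finite_measure R" "sets R = sets Q" for R
  proof -
    interpret R: finite_measure R by fact
    note [measurable_cong] = that(2)
    have "(\<integral>x. ?h J x *\<^sub>R (1::complex) \<partial>R)
        = (\<integral>x. of_real (indicator {x\<in>space R. \<forall>j\<in>J. V j x \<in> A j} x) \<partial>R)"
    proof (intro Bochner_Integration.integral_cong refl)
      fix x assume "x \<in> space R"
      then show "?h J x *\<^sub>R (1::complex) = of_real (indicator {x\<in>space R. \<forall>j\<in>J. V j x \<in> A j} x)"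
        using fin by (auto simp: indicator_def of_real_def[symmetric] split: if_splits intro!: prod.neutral)
    qed
    also have "\<dots> = of_real (measure R {x\<in>space R. \<forall>j\<in>J. V j x \<in> A j})"
    proof -
      have "{x\<in>space R. \<forall>j\<in>J. V j x \<in> A j} \<in> sets R"
        using fin by measurable
      then show ?thesis
        by (simp add: integral_complex_of_real)
    qed
    finally show ?thesis by simp
  qed
  from this[OF P assms(3)] this[OF Q refl]
  have "complex_of_real (measure P {x\<in>space P. \<forall>j\<in>J. V j x \<in> A j})
      = of_real (measure Q {x\<in>space Q. \<forall>j\<in>J. V j x \<in> A j})"
    by (simp only: J)
  then show ?thesis
    by (simp only: of_real_eq_iff)
qed

section \<open>Measurability and integration of vectors by components\<close>

lemma borel_measurable_vec_nth [measurable (raw)]: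
  fixes f :: "'a \<Rightarrow> 'b::euclidean_space ^ 'm"
  assumes "f \<in> borel_measurable M"
  shows "(\<lambda>x. f x $ i) \<in> borel_measurable M"
proof -
  have "(\<lambda>v :: 'b ^ 'm. v $ i) \<in> borel_measurable borel"
    by (intro borel_measurable_continuous_onI continuous_intros)
  from measurable_compose[OF assms this] show ?thesis .
qed

lemma borel_measurable_vecI:
  fixes f :: "'a \<Rightarrow> 'b::euclidean_space ^ 'm"
  assumes [measurable]: "\<And>i. (\<lambda>x. f x $ i) \<in> borel_measurable M"
  shows "f \<in> borel_measurable M"
  unfolding borel_measurable_euclidean_space[where 'c="'b ^ 'm"]
  by (auto simp: Basis_vec_def inner_axis)

lemma borel_measurable_vec_lambda [measurable (raw)]:
  fixes f :: "'a \<Rightarrow> 'm::finite \<Rightarrow> 'b::euclidean_space"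
  assumes "\<And>i. (\<lambda>x. f x i) \<in> borel_measurable M"
  shows "(\<lambda>x. \<chi> i. f x i) \<in> borel_measurable M"
  using assms by (intro borel_measurable_vecI) simp

lemma integrable_vecI:
  fixes f :: "'a \<Rightarrow> 'b::euclidean_space ^ 'm"
  assumes "\<And>i. integrable M (\<lambda>x. f x $ i)"
  shows "integrable M f"
proof (rule Bochner_Integration.integrable_bound)
  show "integrable M (\<lambda>x. \<Sum>i\<in>UNIV. norm (f x $ i))"
    using assms by (intro Bochner_Integration.integrable_sum integrable_norm)
  show "f \<in> borel_measurable M"
    using assms by (intro borel_measurable_vecI) auto
  show "AE x in M. norm (f x) \<le> norm (\<Sum>i\<in>UNIV. norm (f x $ i))"
    by (auto simp: norm_vec_def sum_nonneg intro!: L2_set_le_sum)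
qed

lemma integral_vec_nth:
  fixes f :: "'a \<Rightarrow> 'b::euclidean_space ^ 'm"
  assumes "\<And>i. integrable M (\<lambda>x. f x $ i)"
  shows "(\<integral>x. f x \<partial>M) $ i = (\<integral>x. f x $ i \<partial>M)"
  using integral_bounded_linear[OF bounded_linear_vec_nth integrable_vecI[OF assms], of i] by simp

text \<open>A family of vectors over \<open>I\<close> is the same as a family of reals over
  \<open>K\<close>, the pairs of an index and a component. After this flattening, finite-dimensional
  boxes in real coordinates determine a finite measure, and
  \<open>box_measure_eq_of_iexp_integrals\<close> treats them.\<close>

lemma PiM_vec_measure_eqI:
  fixes P Q :: "('i \<Rightarrow> real ^ 'm) measure"
  assumes P: "finite_measure P" and Q: "finite_measure Q"
    and sP: "sets P = sets (Pi\<^sub>M I (\<lambda>_. borel))" and sQ: "sets Q = sets (Pi\<^sub>M I (\<lambda>_. borel))"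
    and eq: "\<And>J c. finite J \<Longrightarrow> J \<subseteq> I \<Longrightarrow>
      (\<integral>x. iexp (\<Sum>j\<in>J. c j \<bullet> x j) \<partial>P) = (\<integral>x. iexp (\<Sum>j\<in>J. c j \<bullet> x j) \<partial>Q)"
  shows "P = Q"
proof -
  note [measurable_cong] = sP sQ
  define K where "K = I \<times> (UNIV :: 'm set)"
  define \<pi> where "\<pi> x = (\<lambda>p\<in>K. x (fst p) $ snd p)" for x :: "'i \<Rightarrow> real ^ 'm"
  define \<sigma> where "\<sigma> y = (\<lambda>i\<in>I. \<chi> k. y (i, k))" for y :: "'i \<times> 'm \<Rightarrow> real"
  have comp: "(\<lambda>x. x (fst p) $ snd p) \<in> borel_measurable (Pi\<^sub>M I (\<lambda>_. borel :: (real ^ 'm) measure))"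
    if "p \<in> K" for p
    using that by (intro borel_measurable_vec_nth measurable_component_singleton) (auto simp: K_def)
  have \<pi>: "\<pi> \<in> Pi\<^sub>M I (\<lambda>_. borel) \<rightarrow>\<^sub>M Pi\<^sub>M K (\<lambda>_. borel)"
    unfolding \<pi>_def by (intro measurable_restrict comp)
  have \<sigma>: "\<sigma> \<in> Pi\<^sub>M K (\<lambda>_. borel) \<rightarrow>\<^sub>M Pi\<^sub>M I (\<lambda>_. borel)"
    unfolding \<sigma>_def
    by (intro measurable_restrict borel_measurable_vec_lambda measurable_component_singleton)
       (auto simp: K_def)
  \<comment> \<open>As \<open>\<sigma>\<close> is a measurable left inverse of \<open>\<pi>\<close>,
    each measure is recovered from its flattened image, and equality of the images carries
    back.\<close>
  have \<sigma>\<pi>: "\<sigma> (\<pi> x) = x" if "x \<in> space (Pi\<^sub>M I (\<lambda>_. borel :: (real ^ 'm) measure))" for x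
    using that by (auto simp: \<sigma>_def \<pi>_def K_def space_PiM fun_eq_iff vec_eq_iff PiE_def extensional_def)
  have \<pi>P: "\<pi> \<in> P \<rightarrow>\<^sub>M Pi\<^sub>M K (\<lambda>_. borel)" and \<pi>Q: "\<pi> \<in> Q \<rightarrow>\<^sub>M Pi\<^sub>M K (\<lambda>_. borel)"
    using \<pi> sP sQ by (simp_all cong: measurable_cong_sets)
  have "distr P (Pi\<^sub>M K (\<lambda>_. borel)) \<pi> = distr Q (Pi\<^sub>M K (\<lambda>_. borel)) \<pi>"
  proof (rule measure_eqI_PiM_infinite)
    fix J A assume J: "finite J" "J \<subseteq> K" and A: "\<And>i. i \<in> J \<Longrightarrow> A i \<in> sets (borel :: real measure)"
    let ?E = "prod_emb K (\<lambda>_. borel :: real measure) J (Pi\<^sub>E J A)"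
    have E: "?E \<in> sets (Pi\<^sub>M K (\<lambda>_. borel))"
      using J A by (intro sets_PiM_I) auto
    have pre: "\<pi> -` ?E \<inter> space R = {x\<in>space R. \<forall>p\<in>J. x (fst p) $ snd p \<in> A p}" for R
    proof -
      have "\<pi> x p = x (fst p) $ snd p" if "p \<in> J" for x p
        using that J by (auto simp: \<pi>_def)
      moreover have "\<pi> x \<in> extensional K" for x
        by (simp add: \<pi>_def)
      ultimately have "\<pi> x \<in> ?E \<longleftrightarrow> (\<forall>p\<in>J. x (fst p) $ snd p \<in> A p)" for x
        by (simp add: prod_emb_iff PiE_iff cong: ball_cong)
      then show ?thesis by blast
    qed
    \<comment> \<open>A combination of finitely many scalar components is one of the finitely many
      vectors they belong to; components outside \<open>J\<close> receive coefficient 0.\<close>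
    have lin: "(\<Sum>p\<in>J. d p * (x (fst p) $ snd p))
        = (\<Sum>j\<in>fst ` J. (\<chi> k. if (j, k) \<in> J then d (j, k) else 0) \<bullet> x j)" for d and x :: "'i \<Rightarrow> real ^ 'm"
    proof -
      have "(\<Sum>j\<in>fst ` J. (\<chi> k. if (j, k) \<in> J then d (j, k) else 0) \<bullet> x j)
          = (\<Sum>j\<in>fst ` J. \<Sum>k\<in>UNIV. (if (j, k) \<in> J then d (j, k) else 0) * x j $ k)"
        by (simp add: inner_vec_def)
      also have "\<dots> = (\<Sum>p\<in>fst ` J \<times> UNIV. (if p \<in> J then d p else 0) * x (fst p) $ snd p)"
        unfolding sum.cartesian_product by (intro sum.cong) auto
      also have "\<dots> = (\<Sum>p\<in>J. d p * (x (fst p) $ snd p))"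
        using J by (intro sum.mono_neutral_cong_right) force+
      finally show ?thesis by simp
    qed
    have "measure P {x\<in>space P. \<forall>p\<in>J. x (fst p) $ snd p \<in> A p}
        = measure Q {x\<in>space Q. \<forall>p\<in>J. x (fst p) $ snd p \<in> A p}"
    proof (rule box_measure_eq_of_iexp_integrals[OF P Q])
      show "(\<lambda>x. x (fst p) $ snd p) \<in> borel_measurable Q" if "p \<in> J" for p
        using comp that J sQ by (auto cong: measurable_cong_sets)
      show "(\<integral>x. iexp (\<Sum>p\<in>J. d p * (x (fst p) $ snd p)) \<partial>P)
          = (\<integral>x. iexp (\<Sum>p\<in>J. d p * (x (fst p) $ snd p)) \<partial>Q)" for d
        unfolding lin using J by (intro eq) (auto simp: K_def)
    qed (use J A sP sQ in auto)
    then show "emeasure (distr P (Pi\<^sub>M K (\<lambda>_. borel)) \<pi>) ?E = emeasure (distr Q (Pi\<^sub>M K (\<lambda>_. borel)) \<pi>) ?E"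
      using P Q E \<pi>P \<pi>Q
      by (simp add: emeasure_distr pre finite_measure.emeasure_eq_measure)
  qed (use P \<pi>P in \<open>auto intro: finite_measure.finite_measure_distr\<close>)
  then have "distr (distr P (Pi\<^sub>M K (\<lambda>_. borel)) \<pi>) (Pi\<^sub>M I (\<lambda>_. borel)) \<sigma>
      = distr (distr Q (Pi\<^sub>M K (\<lambda>_. borel)) \<pi>) (Pi\<^sub>M I (\<lambda>_. borel)) \<sigma>"
    by simp
  moreover have "distr (distr R (Pi\<^sub>M K (\<lambda>_. borel)) \<pi>) (Pi\<^sub>M I (\<lambda>_. borel)) \<sigma> = R"
    if s: "sets R = sets (Pi\<^sub>M I (\<lambda>_. borel))" for R
  proof -
    have "\<pi> \<in> R \<rightarrow>\<^sub>M Pi\<^sub>M K (\<lambda>_. borel)"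
      using \<pi> s by (simp cong: measurable_cong_sets)
    then have "distr (distr R (Pi\<^sub>M K (\<lambda>_. borel)) \<pi>) (Pi\<^sub>M I (\<lambda>_. borel)) \<sigma>
        = distr R (Pi\<^sub>M I (\<lambda>_. borel)) (\<lambda>x. x)"
      using s \<sigma>\<pi> sets_eq_imp_space_eq[OF s] \<sigma> by (auto simp: distr_distr intro!: distr_cong)
    also have "\<dots> = R" using s by (simp add: distr_id2)
    finally show ?thesis .
  qed
  ultimately show ?thesis using sP sQ by metis
qed

section \<open>Normal laws and Gaussian processes\<close>

text \<open>The affine image of a standard normal variable covers \<open>\<sigma> = 0\<close> and
  \<open>\<sigma> > 0\<close> alike, so the facts below are proved without treating point masses
  separately.\<close>

lemma normal_law_eq_distr_std_normal:
  assumes "\<sigma> \<ge> 0"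
  shows "normal_law \<mu> \<sigma> = distr std_normal_distribution borel (\<lambda>x. \<mu> + \<sigma> * x)"
proof -
  interpret S: real_distribution std_normal_distribution by (rule real_dist_normal_dist)
  show ?thesis
  proof (cases "\<sigma> = 0")
    case True
    then show ?thesis by (simp add: normal_law_def S.distr_const)
  next
    case False
    have "distributed std_normal_distribution lborel (\<lambda>x. x) std_normal_density"
      unfolding distributed_def by (auto simp: distr_id2)
    from S.normal_density_affine[OF this, of \<sigma> \<mu>] False assms
    have "distr std_normal_distribution lborel (\<lambda>x. \<mu> + \<sigma> * x) = density lborel (normal_density \<mu> \<sigma>)"
      unfolding distributed_def by simp
    then show ?thesis
      using False by (simp add: normal_law_def cong: distr_cong)
  qed
qed

lemma
  assumes distr: "distr M borel Y = normal_law \<mu> \<sigma>" and "\<sigma> \<ge> 0"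
    and Y [measurable]: "Y \<in> borel_measurable M"
  shows normal_law_integrable: "integrable M Y"
    and normal_law_integrable_square: "integrable M (\<lambda>x. (Y x)\<^sup>2)"
    and normal_law_mean: "(\<integral>x. Y x \<partial>M) = \<mu>"
    and normal_law_second_moment: "(\<integral>x. (Y x)\<^sup>2 \<partial>M) = \<mu>\<^sup>2 + \<sigma>\<^sup>2"
    and normal_law_char: "(\<integral>x. iexp (Y x) \<partial>M) = iexp \<mu> * exp (- (of_real (\<sigma>\<^sup>2) / 2))"
proof -
  let ?N = "std_normal_distribution"
  interpret S: real_distribution ?N by (rule real_dist_normal_dist)
  have distr': "distr M borel Y = distr ?N borel (\<lambda>x. \<mu> + \<sigma> * x)"
    using assms by (simp add: normal_law_eq_distr_std_normal)
  \<comment> \<open>Every integral of a function of \<open>Y\<close> becomes one against the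
    standard normal law, so only its first two moments and its characteristic function
    enter.\<close>
  have transfer: "(\<integral>x. f (Y x) \<partial>M) = (\<integral>x. f (\<mu> + \<sigma> * x) \<partial>?N)"
    if [measurable]: "f \<in> borel_measurable borel" for f :: "real \<Rightarrow> 'b::{banach, second_countable_topology}"
    using arg_cong[OF distr', of "\<lambda>R. integral\<^sup>L R f"] by (simp add: integral_distr)
  have transfer_int: "integrable M (\<lambda>x. f (Y x)) \<longleftrightarrow> integrable ?N (\<lambda>x. f (\<mu> + \<sigma> * x))"
    if [measurable]: "f \<in> borel_measurable borel" for f :: "real \<Rightarrow> real"
    using arg_cong[OF distr', of "\<lambda>R. integrable R f"] by (simp add: integrable_distr_eq)
  have i1[simp]: "integrable ?N (\<lambda>x. x)" and i2[simp]: "integrable ?N (\<lambda>x. x\<^sup>2)"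
    using integrable_std_normal_distribution_moment[of 1] integrable_std_normal_distribution_moment[of 2]
    by simp_all
  have m1: "(\<integral>x. x \<partial>?N) = 0" using integral_std_normal_distribution_moment_odd[of 1] by simp
  have m2: "(\<integral>x. x\<^sup>2 \<partial>?N) = 1"
    using std_normal_distribution_even_moments(1)[of 1] by simp
  have i: "integrable ?N (\<lambda>x. \<mu> + \<sigma> * x)"
    by (intro Bochner_Integration.integrable_add integrable_mult_right) auto
  show "integrable M Y" using transfer_int[of "\<lambda>x. x"] i by simp
  have sq: "(\<lambda>x. (\<mu> + \<sigma> * x)\<^sup>2) = (\<lambda>x. \<mu>\<^sup>2 + ((2 * \<mu> * \<sigma>) * x + \<sigma>\<^sup>2 * x\<^sup>2))"
    by (auto simp: power2_eq_square algebra_simps)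
  have i': "integrable ?N (\<lambda>x. (2 * \<mu> * \<sigma>) * x + \<sigma>\<^sup>2 * x\<^sup>2)"
    by (intro Bochner_Integration.integrable_add integrable_mult_right) auto
  then have "integrable ?N (\<lambda>x. (\<mu> + \<sigma> * x)\<^sup>2)"
    unfolding sq by (intro Bochner_Integration.integrable_add) auto
  then show "integrable M (\<lambda>x. (Y x)\<^sup>2)" using transfer_int[of "\<lambda>x. x\<^sup>2"] by simp
  have "(\<integral>x. \<mu> + \<sigma> * x \<partial>?N) = \<mu> + \<sigma> * 0"
    by (subst Bochner_Integration.integral_add) (auto simp: m1 S.prob_space[simplified])
  then show "(\<integral>x. Y x \<partial>M) = \<mu>" using transfer[of "\<lambda>x. x"] by simp
  have "(\<integral>x. (\<mu> + \<sigma> * x)\<^sup>2 \<partial>?N) = \<mu>\<^sup>2 + ((2 * \<mu> * \<sigma>) * 0 + \<sigma>\<^sup>2 * 1)"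
    unfolding sq using i'
    by (simp add: m1 m2 S.prob_space[simplified])
  then show "(\<integral>x. (Y x)\<^sup>2 \<partial>M) = \<mu>\<^sup>2 + \<sigma>\<^sup>2" using transfer[of "\<lambda>x. x\<^sup>2"] by simp
  have "(\<integral>x. iexp (\<mu> + \<sigma> * x) \<partial>?N) = iexp \<mu> * char ?N \<sigma>"
    unfolding char_def integral_mult_right_zero[symmetric]
    by (simp add: mult_exp_exp algebra_simps)
  then show "(\<integral>x. iexp (Y x) \<partial>M) = iexp \<mu> * exp (- (of_real (\<sigma>\<^sup>2) / 2))"
    using transfer[of iexp] by (simp add: char_std_normal_distribution exp_of_real[symmetric])
qed

lemma distr_add_const_normal_law:
  assumes "distr M borel Y = normal_law \<mu> \<sigma>" "\<sigma> \<ge> 0" and [measurable]: "Y \<in> borel_measurable M"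
  shows "distr M borel (\<lambda>x. Y x + a) = normal_law (\<mu> + a) \<sigma>"
proof -
  have "distr M borel (\<lambda>x. Y x + a) = distr (distr M borel Y) borel (\<lambda>x. x + a)"
    by (simp add: distr_distr comp_def)
  also have "\<dots> = distr (distr std_normal_distribution borel (\<lambda>x. \<mu> + \<sigma> * x)) borel (\<lambda>x. x + a)"
    using assms by (simp add: normal_law_eq_distr_std_normal)
  also have "\<dots> = normal_law (\<mu> + a) \<sigma>"
    using assms by (simp add: distr_distr comp_def normal_law_eq_distr_std_normal algebra_simps)
  finally show ?thesis .
qed

lemma integrable_mult_of_squares:
  fixes f g :: "'a \<Rightarrow> real"
  assumes "integrable M (\<lambda>x. (f x)\<^sup>2)" "integrable M (\<lambda>x. (g x)\<^sup>2)"
    and [measurable]: "f \<in> borel_measurable M" "g \<in> borel_measurable M"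
  shows "integrable M (\<lambda>x. f x * g x)"
proof (rule Bochner_Integration.integrable_bound)
  show "integrable M (\<lambda>x. (f x)\<^sup>2 + (g x)\<^sup>2)"
    using assms by simp
  have "\<bar>f x * g x\<bar> \<le> (f x)\<^sup>2 + (g x)\<^sup>2" for x
    using sum_squares_bound[of "\<bar>f x\<bar>" "\<bar>g x\<bar>"] abs_ge_zero[of "f x * g x"]
    unfolding abs_mult power2_abs by linarith
  then show "AE x in M. norm (f x * g x) \<le> norm ((f x)\<^sup>2 + (g x)\<^sup>2)"
    by simp
qed simp

lemma gaussian_process_mono:
  "gaussian_process M I X \<Longrightarrow> I' \<subseteq> I \<Longrightarrow> gaussian_process M I' X"
  unfolding gaussian_process_def by (metis subset_trans subsetD)

lemma gaussian_process_measurable: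
  "gaussian_process M I X \<Longrightarrow> t \<in> I \<Longrightarrow> X t \<in> borel_measurable M"
  unfolding gaussian_process_def by simp

lemma gaussian_process_combination:
  assumes "gaussian_process M I X" "finite J" "J \<subseteq> I"
  obtains \<mu> \<sigma> where "\<sigma> \<ge> 0" "distr M borel (\<lambda>\<omega>. \<Sum>j\<in>J. c j \<bullet> X j \<omega>) = normal_law \<mu> \<sigma>"
proof -
  have "jointly_normal M J X"
    using assms unfolding gaussian_process_def by blast
  then have "\<exists>\<mu> \<sigma>. \<sigma> \<ge> 0 \<and> distr M borel (\<lambda>\<omega>. \<Sum>j\<in>J. c j \<bullet> X j \<omega>) = normal_law \<mu> \<sigma>"
    unfolding jointly_normal_def by (rule spec)
  then show thesis
    using that by blast
qed

text \<open>For a combination of mean zero, the parameters of its normal law are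
  \<open>\<mu> = 0\<close> and \<sigma> squared equal to the second moment. The characteristic
  function thus depends on the second moment alone, which is what lets vanishing correlation decide
  independence.\<close>

lemma
  assumes G: "gaussian_process M I X" and J: "finite J" "J \<subseteq> I"
  shows gaussian_process_combination_measurable:
      "(\<lambda>\<omega>. \<Sum>j\<in>J. c j \<bullet> X j \<omega>) \<in> borel_measurable M"
    and gaussian_process_combination_integrable:
      "integrable M (\<lambda>\<omega>. \<Sum>j\<in>J. c j \<bullet> X j \<omega>)"
    and gaussian_process_combination_square_integrable:
      "integrable M (\<lambda>\<omega>. (\<Sum>j\<in>J. c j \<bullet> X j \<omega>)\<^sup>2)"
    and gaussian_process_combination_char:
      "(\<integral>\<omega>. (\<Sum>j\<in>J. c j \<bullet> X j \<omega>) \<partial>M) = 0 \<Longrightarrow>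
        (\<integral>\<omega>. iexp (\<Sum>j\<in>J. c j \<bullet> X j \<omega>) \<partial>M) = exp (- of_real ((\<integral>\<omega>. (\<Sum>j\<in>J. c j \<bullet> X j \<omega>)\<^sup>2 \<partial>M)) / 2)"
proof -
  show meas: "(\<lambda>\<omega>. \<Sum>j\<in>J. c j \<bullet> X j \<omega>) \<in> borel_measurable M"
    using J gaussian_process_measurable[OF G]
    by (intro borel_measurable_sum borel_measurable_inner borel_measurable_const) blast
  obtain \<mu> \<sigma> where n: "\<sigma> \<ge> 0" "distr M borel (\<lambda>\<omega>. \<Sum>j\<in>J. c j \<bullet> X j \<omega>) = normal_law \<mu> \<sigma>"
    using gaussian_process_combination[OF G J] by blast
  note facts = n(2) n(1) meas
  show "integrable M (\<lambda>\<omega>. \<Sum>j\<in>J. c j \<bullet> X j \<omega>)"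
    using facts by (rule normal_law_integrable)
  show "integrable M (\<lambda>\<omega>. (\<Sum>j\<in>J. c j \<bullet> X j \<omega>)\<^sup>2)"
    using facts by (rule normal_law_integrable_square)
  assume "(\<integral>\<omega>. (\<Sum>j\<in>J. c j \<bullet> X j \<omega>) \<partial>M) = 0"
  then have "\<mu> = 0" using normal_law_mean[OF facts] by simp
  then show "(\<integral>\<omega>. iexp (\<Sum>j\<in>J. c j \<bullet> X j \<omega>) \<partial>M) = exp (- of_real ((\<integral>\<omega>. (\<Sum>j\<in>J. c j \<bullet> X j \<omega>)\<^sup>2 \<partial>M)) / 2)"
    using normal_law_second_moment[OF facts] normal_law_char[OF facts] by simp
qed

lemma
  assumes "gaussian_process M I X" "t \<in> I"
  shows gaussian_process_nth_integrable: "integrable M (\<lambda>\<omega>. X t \<omega> $ i)"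
    and gaussian_process_nth_square_integrable: "integrable M (\<lambda>\<omega>. (X t \<omega> $ i)\<^sup>2)"
proof -
  have "(\<Sum>j\<in>{t}. axis i 1 \<bullet> X j \<omega>) = X t \<omega> $ i" for \<omega>
    by (simp add: inner_axis')
  then show "integrable M (\<lambda>\<omega>. X t \<omega> $ i)" "integrable M (\<lambda>\<omega>. (X t \<omega> $ i)\<^sup>2)"
    using gaussian_process_combination_integrable[OF assms(1), of "{t}" "\<lambda>_. axis i 1"]
      gaussian_process_combination_square_integrable[OF assms(1), of "{t}" "\<lambda>_. axis i 1"] assms(2)
    by simp_all
qed

lemma gaussian_process_mult_integrable:
  assumes G: "gaussian_process M I X" and "t \<in> I" "s \<in> I"
  shows "integrable M (\<lambda>\<omega>. X t \<omega> $ i * X s \<omega> $ j)"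
proof (rule integrable_mult_of_squares)
  show "(\<lambda>\<omega>. X t \<omega> $ i) \<in> borel_measurable M" "(\<lambda>\<omega>. X s \<omega> $ j) \<in> borel_measurable M"
    using assms by (auto intro: borel_measurable_vec_nth gaussian_process_measurable)
qed (use assms in \<open>auto intro: gaussian_process_nth_square_integrable\<close>)

section \<open>Regression of a Gaussian process on one of its values\<close>

lemma subalgebra_sigma_gen:
  "Z \<in> borel_measurable M \<Longrightarrow> subalgebra M (sigma_gen M Z)"
  unfolding subalgebra_def sigma_gen_def
  by (auto simp: sets_vimage_algebra2 measurable_sets)

lemma (in prob_space) sigma_finite_subalgebra_sigma_gen:
  assumes "Z \<in> borel_measurable M"
  shows "sigma_finite_subalgebra M (sigma_gen M Z)"
  by (intro finite_measure_subalgebra_is_sigma_finite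
      finite_measure_subalgebra.intro finite_measure_subalgebra_axioms.intro
      subalgebra_sigma_gen assms finite_measure_axioms)

text \<open>The freezing principle: under independence, \<open>Z\<close> is held fixed and
  \<open>W\<close> is integrated out. The conditional law, the conditional mean and the conditional
  covariance are all obtained from it by a choice of \<open>f\<close>.\<close>

lemma (in prob_space) real_cond_exp_sigma_gen_indep:
  fixes Z :: "'a \<Rightarrow> real ^ 'k" and f :: "(real ^ 'k) \<times> 'b \<Rightarrow> real"
  assumes Z[measurable]: "Z \<in> borel_measurable M" and W[measurable]: "W \<in> M \<rightarrow>\<^sub>M N"
    and ind: "distr M (borel \<Otimes>\<^sub>M N) (\<lambda>\<omega>. (Z \<omega>, W \<omega>)) = distr M borel Z \<Otimes>\<^sub>M distr M N W"
    and f[measurable]: "f \<in> borel_measurable (borel \<Otimes>\<^sub>M N)"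
    and int: "integrable M (\<lambda>\<omega>. f (Z \<omega>, W \<omega>))"
  shows "AE \<omega> in M. real_cond_exp M (sigma_gen M Z) (\<lambda>\<omega>. f (Z \<omega>, W \<omega>)) \<omega> = (\<integral>\<omega>'. f (Z \<omega>, W \<omega>') \<partial>M)"
proof -
  define D1 where "D1 = distr M borel Z"
  define D2 where "D2 = distr M N W"
  have [measurable_cong]: "sets D1 = sets borel" "sets D2 = sets N" by (auto simp: D1_def D2_def)
  interpret D1: prob_space D1 unfolding D1_def by (rule prob_space_distr) simp
  interpret D2: prob_space D2 unfolding D2_def by (rule prob_space_distr) simp
  interpret D: pair_prob_space D1 D2 ..
  have joint: "D1 \<Otimes>\<^sub>M D2 = distr M (borel \<Otimes>\<^sub>M N) (\<lambda>x. (Z x, W x))"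
    using ind unfolding D1_def D2_def by simp
  define g where "g z = (\<integral>w. f (z, w) \<partial>D2)" for z
  have g[measurable]: "g \<in> borel_measurable borel"
    unfolding g_def by measurable
  have gM: "g (Z \<omega>) = (\<integral>\<omega>'. f (Z \<omega>, W \<omega>') \<partial>M)" for \<omega>
    unfolding g_def D2_def by (simp add: integral_distr)
  interpret F: sigma_finite_subalgebra M "sigma_gen M Z"
    by (rule sigma_finite_subalgebra_sigma_gen) simp
  have intD: "integrable (D1 \<Otimes>\<^sub>M D2) f"
    using int unfolding joint by (simp add: integrable_distr_eq)
  have "AE \<omega> in M. real_cond_exp M (sigma_gen M Z) (\<lambda>\<omega>. f (Z \<omega>, W \<omega>)) \<omega> = g (Z \<omega>)"
  proof (rule F.real_cond_exp_charact)
    show "integrable M (\<lambda>\<omega>. f (Z \<omega>, W \<omega>))" by fact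
    have "integrable D1 g" unfolding g_def using D.integrable_fst'[OF intD] .
    then show "integrable M (\<lambda>\<omega>. g (Z \<omega>))" unfolding D1_def by (simp add: integrable_distr_eq)
    have "Z \<in> borel_measurable (sigma_gen M Z)"
      unfolding sigma_gen_def by (rule measurable_vimage_algebra1) auto
    then show "(\<lambda>\<omega>. g (Z \<omega>)) \<in> borel_measurable (sigma_gen M Z)" by simp
    fix A assume "A \<in> sets (sigma_gen M Z)"
    \<comment> \<open>Every test event is a preimage under \<open>Z\<close>, so its indicator is a
      function of \<open>Z\<close>. The test integral then lives on the joint law, which is a
      product, and Fubini's theorem integrates out \<open>W\<close>.\<close>
    then obtain B where [measurable]: "B \<in> sets borel" and A: "A = Z -` B \<inter> space M"
      by (auto simp: sigma_gen_def sets_vimage_algebra2)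
    have "(\<integral>\<omega>\<in>A. f (Z \<omega>, W \<omega>) \<partial>M) = (\<integral>\<omega>. indicator B (Z \<omega>) * f (Z \<omega>, W \<omega>) \<partial>M)"
      unfolding set_lebesgue_integral_def A
      by (intro Bochner_Integration.integral_cong) (auto simp: indicator_def)
    also have "\<dots> = (\<integral>p. indicator B (fst p) * f p \<partial>(D1 \<Otimes>\<^sub>M D2))"
      unfolding joint by (subst integral_distr) auto
    also have "\<dots> = (\<integral>z. \<integral>w. indicator B (fst (z, w)) * f (z, w) \<partial>D2 \<partial>D1)"
    proof (rule D.integral_fst'[symmetric])
      have "integrable (D1 \<Otimes>\<^sub>M D2) (\<lambda>p. indicator (B \<times> space N) p *\<^sub>R f p)"
        by (intro integrable_mult_indicator intD) auto
      then show "integrable (D1 \<Otimes>\<^sub>M D2) (\<lambda>p. indicator B (fst p) * f p)"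
        by (rule Bochner_Integration.integrable_cong[THEN iffD1, rotated 2])
           (auto simp: indicator_def space_pair_measure D2_def)
    qed
    also have "\<dots> = (\<integral>z. indicator B z * g z \<partial>D1)"
      by (simp add: g_def)
    also have "\<dots> = (\<integral>\<omega>. indicator B (Z \<omega>) * g (Z \<omega>) \<partial>M)"
      unfolding D1_def by (subst integral_distr) auto
    also have "\<dots> = (\<integral>\<omega>\<in>A. g (Z \<omega>) \<partial>M)"
      unfolding set_lebesgue_integral_def A
      by (intro Bochner_Integration.integral_cong) (auto simp: indicator_def)
    finally show "(\<integral>\<omega>\<in>A. f (Z \<omega>, W \<omega>) \<partial>M) = (\<integral>\<omega>\<in>A. g (Z \<omega>) \<partial>M)" .
  qed
  then show ?thesis by (simp only: gM)
qed

text \<open>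
  Replacing \<open>X u\<close> by an independent copy in \<open>X t = (X t - a t X u) + a t X u\<close> does not change
  the law of the process, because the characteristic functions of all finite linear combinations
  only depend on the second moments.
\<close>
lemma (in prob_space) gaussian_process_residual_indep:
  fixes X :: "'i \<Rightarrow> 'a \<Rightarrow> real ^ 'm" and a :: "'i \<Rightarrow> real"
  assumes G: "gaussian_process M I X" and u: "u \<in> I" and au: "a u = 1"
    and mean: "\<And>t i. t \<in> I \<Longrightarrow> expectation (\<lambda>\<omega>. X t \<omega> $ i) = 0"
    and uncorr: "\<And>t i j. t \<in> I \<Longrightarrow>
      expectation (\<lambda>\<omega>. X u \<omega> $ i * (X t \<omega> - a t *\<^sub>R X u \<omega>) $ j) = 0"
  shows "distr M (borel \<Otimes>\<^sub>M Pi\<^sub>M I (\<lambda>_. borel)) (\<lambda>\<omega>. (X u \<omega>, \<lambda>t\<in>I. X t \<omega> - a t *\<^sub>R X u \<omega>))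
      = distr M borel (X u) \<Otimes>\<^sub>M distr M (Pi\<^sub>M I (\<lambda>_. borel)) (\<lambda>\<omega>. \<lambda>t\<in>I. X t \<omega> - a t *\<^sub>R X u \<omega>)"
proof -
  let ?N = "Pi\<^sub>M I (\<lambda>_. borel :: (real ^ 'm) measure)"
  define R where "R t \<omega> = X t \<omega> - a t *\<^sub>R X u \<omega>" for t \<omega>
  note X[measurable] = gaussian_process_measurable[OF G]
  have Xu[measurable]: "X u \<in> borel_measurable M" using u by simp
  have R[measurable]: "R t \<in> borel_measurable M" if "t \<in> I" for t
    unfolding R_def using that by measurable
  have mean_comb: "expectation (\<lambda>\<omega>. \<Sum>j\<in>J. c j \<bullet> X j \<omega>) = 0" if "J \<subseteq> I" for J c
  proof -
    have "expectation (\<lambda>\<omega>. \<Sum>j\<in>J. c j \<bullet> X j \<omega>) = (\<Sum>j\<in>J. \<Sum>i\<in>UNIV. c j $ i * expectation (\<lambda>\<omega>. X j \<omega> $ i))"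
      unfolding inner_vec_def using that gaussian_process_nth_integrable[OF G]
      by (simp add: subset_iff)
    then show ?thesis using that mean by (simp add: subset_iff)
  qed
  have comb: "integrable M (\<lambda>\<omega>. (\<Sum>j\<in>J. c j \<bullet> X j \<omega>)\<^sup>2)"
    "expectation (\<lambda>\<omega>. iexp (\<Sum>j\<in>J. c j \<bullet> X j \<omega>)) = exp (- of_real (expectation (\<lambda>\<omega>. (\<Sum>j\<in>J. c j \<bullet> X j \<omega>)\<^sup>2)) / 2)"
    if "finite J" "J \<subseteq> I" for J c
    using that gaussian_process_combination_square_integrable[OF G that]
      gaussian_process_combination_char[OF G that mean_comb]
    by auto
  have char_eq: "expectation (\<lambda>\<omega>. iexp (\<Sum>j\<in>J. c j \<bullet> X j \<omega>))
      = (\<integral>p. iexp (\<Sum>j\<in>J. c j \<bullet> (R j (snd p) + a j *\<^sub>R X u (fst p))) \<partial>(M \<Otimes>\<^sub>M M))"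
    if J: "finite J" "J \<subseteq> I" for J c
  proof -
    interpret MM: pair_prob_space M M ..
    \<comment> \<open>Writing \<open>X j = R j + a j *\<^sub>R X u\<close>, the combination splits
      into \<open>U\<close> and \<open>V\<close>, where \<open>d\<close> collects the coefficients
      of \<open>X u\<close>. The family \<open>c'\<close> expresses \<open>V\<close> through
      \<open>X\<close> again, so that \<open>V\<close> is known to be normal; its two case
      distinctions allow for \<open>u\<close> lying inside or outside \<open>J\<close>.\<close>
    define d where "d = (\<Sum>j\<in>J. a j *\<^sub>R c j)"
    define c' where "c' j = (if j \<in> J then c j else 0) - (if j = u then d else 0)" for j
    define U where "U \<omega> = d \<bullet> X u \<omega>" for \<omega>
    define V where "V \<omega> = (\<Sum>j\<in>J. c j \<bullet> R j \<omega>)" for \<omega>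
    have [measurable]: "U \<in> borel_measurable M" unfolding U_def by measurable
    have [measurable]: "V \<in> borel_measurable M"
      unfolding V_def using J by (intro borel_measurable_sum) auto
    have S: "(\<Sum>j\<in>J. c j \<bullet> X j \<omega>) = U \<omega> + V \<omega>" for \<omega>
      by (simp add: U_def V_def d_def R_def inner_diff_right sum_subtractf inner_sum_left)
    have S2: "(\<Sum>j\<in>J. c j \<bullet> (R j \<omega>' + a j *\<^sub>R X u \<omega>)) = U \<omega> + V \<omega>'" for \<omega> \<omega>'
      by (simp add: U_def V_def d_def inner_add_right sum.distrib inner_sum_left)
    have V: "V \<omega> = (\<Sum>j\<in>insert u J. c' j \<bullet> X j \<omega>)" for \<omega>
    proof -
      have "(\<Sum>j\<in>insert u J. c' j \<bullet> X j \<omega>)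
          = (\<Sum>j\<in>insert u J. (if j \<in> J then c j else 0) \<bullet> X j \<omega>) - (\<Sum>j\<in>insert u J. (if j = u then d else 0) \<bullet> X j \<omega>)"
        by (simp add: c'_def inner_diff_left sum_subtractf)
      also have "(\<Sum>j\<in>insert u J. (if j \<in> J then c j else 0) \<bullet> X j \<omega>) = (\<Sum>j\<in>J. c j \<bullet> X j \<omega>)"
        using J by (intro sum.mono_neutral_cong_right) auto
      also have "(\<Sum>j\<in>insert u J. (if j = u then d else 0) \<bullet> X j \<omega>) = (\<Sum>j\<in>{u}. d \<bullet> X j \<omega>)"
        using J by (intro sum.mono_neutral_cong_right) auto
      finally show ?thesis using S[of \<omega>] by (simp add: U_def)
    qed
    have intU: "integrable M (\<lambda>\<omega>. (U \<omega>)\<^sup>2)"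
      and charU: "expectation (\<lambda>\<omega>. iexp (U \<omega>)) = exp (- of_real (expectation (\<lambda>\<omega>. (U \<omega>)\<^sup>2)) / 2)"
      using comb[of "{u}" "\<lambda>_. d"] u by (simp_all add: U_def)
    have intV: "integrable M (\<lambda>\<omega>. (V \<omega>)\<^sup>2)"
      and charV: "expectation (\<lambda>\<omega>. iexp (V \<omega>)) = exp (- of_real (expectation (\<lambda>\<omega>. (V \<omega>)\<^sup>2)) / 2)"
      using comb[of "insert u J" c'] u J by (simp_all only: V[symmetric]) auto
    have charS: "expectation (\<lambda>\<omega>. iexp (U \<omega> + V \<omega>)) = exp (- of_real (expectation (\<lambda>\<omega>. (U \<omega> + V \<omega>)\<^sup>2)) / 2)"
      using comb(2)[OF J, of c] by (simp only: S)
    have intUV: "integrable M (\<lambda>\<omega>. U \<omega> * V \<omega>)"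
      by (intro integrable_mult_of_squares intU intV) auto
    \<comment> \<open>With zero correlation the second moments of \<open>U\<close> and
      \<open>V\<close> add up, hence the characteristic function of \<open>U + V\<close> is the
      product of theirs, just as for independent sample points.\<close>
    have UV: "expectation (\<lambda>\<omega>. U \<omega> * V \<omega>) = 0"
    proof -
      have int: "integrable M (\<lambda>\<omega>. X u \<omega> $ i * R j \<omega> $ k)" if "j \<in> J" for i j k
        using gaussian_process_mult_integrable[OF G u, of j i k]
          gaussian_process_mult_integrable[OF G u u, of i k] that J
        by (auto simp: R_def algebra_simps subset_iff)
      have "U \<omega> * V \<omega> = (\<Sum>j\<in>J. \<Sum>k\<in>UNIV. \<Sum>i\<in>UNIV. d $ i * c j $ k * (X u \<omega> $ i * R j \<omega> $ k))" for \<omega>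
        by (simp add: U_def V_def inner_vec_def sum_distrib_left sum_distrib_right algebra_simps)
      then have "expectation (\<lambda>\<omega>. U \<omega> * V \<omega>)
          = (\<Sum>j\<in>J. \<Sum>k\<in>UNIV. \<Sum>i\<in>UNIV. d $ i * c j $ k * expectation (\<lambda>\<omega>. X u \<omega> $ i * R j \<omega> $ k))"
        using int by simp
      also have "\<dots> = 0"
        using uncorr J by (intro sum.neutral ballI) (auto simp: R_def)
      finally show ?thesis .
    qed
    have "(\<lambda>\<omega>. (U \<omega> + V \<omega>)\<^sup>2) = (\<lambda>\<omega>. (U \<omega>)\<^sup>2 + (V \<omega>)\<^sup>2 + 2 * (U \<omega> * V \<omega>))"
      by (auto simp: power2_eq_square algebra_simps)
    then have var: "expectation (\<lambda>\<omega>. (U \<omega> + V \<omega>)\<^sup>2) = expectation (\<lambda>\<omega>. (U \<omega>)\<^sup>2) + expectation (\<lambda>\<omega>. (V \<omega>)\<^sup>2)"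
      using intU intV intUV UV by simp
    have "(\<integral>p. iexp (U (fst p) + V (snd p)) \<partial>(M \<Otimes>\<^sub>M M))
        = (\<integral>\<omega>. \<integral>\<omega>'. iexp (U (fst (\<omega>, \<omega>')) + V (snd (\<omega>, \<omega>'))) \<partial>M \<partial>M)"
      by (intro MM.integral_fst'[symmetric] MM.integrable_const_bound[of _ 1]) auto
    also have "\<dots> = expectation (\<lambda>\<omega>. iexp (U \<omega>)) * expectation (\<lambda>\<omega>. iexp (V \<omega>))"
      by (simp add: distrib_left exp_add)
    also have "\<dots> = expectation (\<lambda>\<omega>. iexp (U \<omega> + V \<omega>))"
      unfolding charU charV charS var by (simp add: mult_exp_exp diff_divide_distrib)
    finally show ?thesis by (simp only: S S2)
  qed
  define Y where "Y p = (\<lambda>t\<in>I. R t (snd p) + a t *\<^sub>R X u (fst p))" for p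
  have Y[measurable]: "Y \<in> M \<Otimes>\<^sub>M M \<rightarrow>\<^sub>M ?N"
    unfolding Y_def by (intro measurable_restrict) measurable
  have X'[measurable]: "(\<lambda>\<omega>. \<lambda>t\<in>I. X t \<omega>) \<in> M \<rightarrow>\<^sub>M ?N"
    by (intro measurable_restrict) measurable
  have R'[measurable]: "(\<lambda>\<omega>. \<lambda>t\<in>I. R t \<omega>) \<in> M \<rightarrow>\<^sub>M ?N"
    by (intro measurable_restrict) measurable
  interpret MM: pair_prob_space M M ..
  have law: "distr M ?N (\<lambda>\<omega>. \<lambda>t\<in>I. X t \<omega>) = distr (M \<Otimes>\<^sub>M M) ?N Y"
  proof (rule PiM_vec_measure_eqI)
    show "finite_measure (distr M ?N (\<lambda>\<omega>. \<lambda>t\<in>I. X t \<omega>))"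
      by (intro finite_measure_distr X')
    show "finite_measure (distr (M \<Otimes>\<^sub>M M) ?N Y)"
      by (intro MM.finite_measure_distr Y)
    fix J c assume J: "finite J" "J \<subseteq> I"
    have m[measurable]: "(\<lambda>x. \<Sum>j\<in>J. c j \<bullet> x j) \<in> borel_measurable ?N"
      using J by (intro borel_measurable_sum borel_measurable_inner borel_measurable_const
          measurable_component_singleton) auto
    have mi: "(\<lambda>x. iexp (\<Sum>j\<in>J. c j \<bullet> x j)) \<in> borel_measurable ?N"
      by (rule measurable_compose[OF m]) measurable
    have "(\<integral>x. iexp (\<Sum>j\<in>J. c j \<bullet> x j) \<partial>distr M ?N (\<lambda>\<omega>. \<lambda>t\<in>I. X t \<omega>))
        = expectation (\<lambda>\<omega>. iexp (\<Sum>j\<in>J. c j \<bullet> (\<lambda>t\<in>I. X t \<omega>) j))"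
      by (rule integral_distr[OF X' mi])
    also have "\<dots> = expectation (\<lambda>\<omega>. iexp (\<Sum>j\<in>J. c j \<bullet> X j \<omega>))"
      using J by (simp add: subset_iff)
    also have "\<dots> = (\<integral>p. iexp (\<Sum>j\<in>J. c j \<bullet> (R j (snd p) + a j *\<^sub>R X u (fst p))) \<partial>(M \<Otimes>\<^sub>M M))"
      by (rule char_eq[OF J])
    also have "\<dots> = (\<integral>p. iexp (\<Sum>j\<in>J. c j \<bullet> Y p j) \<partial>(M \<Otimes>\<^sub>M M))"
      using J by (simp add: subset_iff Y_def)
    also have "\<dots> = (\<integral>x. iexp (\<Sum>j\<in>J. c j \<bullet> x j) \<partial>distr (M \<Otimes>\<^sub>M M) ?N Y)"
      by (rule integral_distr[OF Y mi, symmetric])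
    finally show "(\<integral>x. iexp (\<Sum>j\<in>J. c j \<bullet> x j) \<partial>distr M ?N (\<lambda>\<omega>. \<lambda>t\<in>I. X t \<omega>))
        = (\<integral>x. iexp (\<Sum>j\<in>J. c j \<bullet> x j) \<partial>distr (M \<Otimes>\<^sub>M M) ?N Y)" .
  qed auto
  \<comment> \<open>The map \<open>\<phi>\<close> reads off the value at \<open>u\<close> and the
    residuals. Since \<open>a u = 1\<close>, the residual at \<open>u\<close> is 0, so on
    \<open>Y\<close> it returns \<open>X u\<close> at the first sample point and the residuals at
    the second; the image of \<open>law\<close> under \<open>\<phi>\<close> is the claimed
    product.\<close>
  define \<phi> where "\<phi> x = (x u, \<lambda>t\<in>I. x t - a t *\<^sub>R x u)" for x :: "'i \<Rightarrow> real ^ 'm"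
  have pu[measurable]: "(\<lambda>x. x u) \<in> ?N \<rightarrow>\<^sub>M borel"
    using u by (intro measurable_component_singleton)
  have \<phi>[measurable]: "\<phi> \<in> ?N \<rightarrow>\<^sub>M borel \<Otimes>\<^sub>M ?N"
    unfolding \<phi>_def by (intro measurable_Pair pu measurable_restrict) measurable
  have \<phi>X: "\<phi> (\<lambda>t\<in>I. X t \<omega>) = (X u \<omega>, \<lambda>t\<in>I. R t \<omega>)" for \<omega>
    using u by (auto simp: \<phi>_def R_def)
  have Ru: "R u \<omega> = 0" for \<omega> by (simp add: R_def au)
  have \<phi>Y: "\<phi> (Y p) = (case p of (\<omega>, \<omega>') \<Rightarrow> (X u \<omega>, \<lambda>t\<in>I. R t \<omega>'))" for p
    using u by (auto simp: \<phi>_def Y_def Ru au split: prod.split)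
  have "distr M (borel \<Otimes>\<^sub>M ?N) (\<lambda>\<omega>. (X u \<omega>, \<lambda>t\<in>I. R t \<omega>))
      = distr (distr M ?N (\<lambda>\<omega>. \<lambda>t\<in>I. X t \<omega>)) (borel \<Otimes>\<^sub>M ?N) \<phi>"
    by (simp add: distr_distr comp_def \<phi>X)
  also have "\<dots> = distr (M \<Otimes>\<^sub>M M) (borel \<Otimes>\<^sub>M ?N) (\<lambda>(\<omega>, \<omega>'). (X u \<omega>, \<lambda>t\<in>I. R t \<omega>'))"
    unfolding law by (simp add: distr_distr comp_def \<phi>Y)
  also have "\<dots> = distr M borel (X u) \<Otimes>\<^sub>M distr M ?N (\<lambda>\<omega>. \<lambda>t\<in>I. R t \<omega>)"
    by (intro pair_measure_distr[symmetric] Xu R')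
       (simp add: prob_space_distr prob_space_imp_sigma_finite)
  finally show ?thesis
    unfolding R_def .
qed

text \<open>The kernel is explicit: \<open>K z\<close> is the law of the residual process shifted by
  \<open>a t *\<^sub>R z\<close>. It depends measurably on \<open>z\<close>, being the image of one
  fixed law under the jointly measurable map \<open>S\<close>, and freezing \<open>X u\<close> in
  the indicator of \<open>S (X u \<omega>, W \<omega>)\<close> identifies it as the conditional
  law.\<close>

lemma (in prob_space) cond_gaussian_process_of_indep:
  fixes X :: "'i \<Rightarrow> 'a \<Rightarrow> real ^ 'm" and a :: "'i \<Rightarrow> real"
  assumes G: "gaussian_process M I X" and u: "u \<in> I"
    and ind: "distr M (borel \<Otimes>\<^sub>M Pi\<^sub>M I (\<lambda>_. borel)) (\<lambda>\<omega>. (X u \<omega>, \<lambda>t\<in>I. X t \<omega> - a t *\<^sub>R X u \<omega>))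
      = distr M borel (X u) \<Otimes>\<^sub>M distr M (Pi\<^sub>M I (\<lambda>_. borel)) (\<lambda>\<omega>. \<lambda>t\<in>I. X t \<omega> - a t *\<^sub>R X u \<omega>)"
  shows "cond_gaussian_process M I X (X u)"
proof -
  let ?N = "Pi\<^sub>M I (\<lambda>_. borel :: (real ^ 'm) measure)"
  define W where "W \<omega> = (\<lambda>t\<in>I. X t \<omega> - a t *\<^sub>R X u \<omega>)" for \<omega>
  define S where "S p = (\<lambda>t\<in>I. snd p t + a t *\<^sub>R fst p)" for p :: "(real ^ 'm) \<times> ('i \<Rightarrow> real ^ 'm)"
  define K where "K z = distr (distr M ?N W) ?N (\<lambda>w. S (z, w))" for z
  note X[measurable] = gaussian_process_measurable[OF G]
  have Xu[measurable]: "X u \<in> borel_measurable M" using u by simp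
  have X'[measurable]: "(\<lambda>\<omega>. \<lambda>t\<in>I. X t \<omega>) \<in> M \<rightarrow>\<^sub>M ?N"
    by (intro measurable_restrict) measurable
  have W[measurable]: "W \<in> M \<rightarrow>\<^sub>M ?N"
    unfolding W_def by (intro measurable_restrict) measurable
  have S[measurable]: "S \<in> borel \<Otimes>\<^sub>M ?N \<rightarrow>\<^sub>M ?N"
    unfolding S_def by (intro measurable_restrict) measurable
  have K: "K z = distr M ?N (\<lambda>\<omega>. S (z, W \<omega>))" for z
    unfolding K_def by (subst distr_distr) (auto simp: comp_def)
  have X_eq: "(\<lambda>t\<in>I. X t \<omega>) = S (X u \<omega>, W \<omega>)" for \<omega>
    by (auto simp: S_def W_def)
  have "regular_cond_distr M ?N (\<lambda>\<omega>. \<lambda>t\<in>I. X t \<omega>) (X u) K"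
    unfolding regular_cond_distr_def
  proof (intro conjI ballI)
    have "distr M ?N W \<in> space (prob_algebra ?N)"
      by (simp add: space_prob_algebra prob_space_distr)
    then show "K \<in> borel \<rightarrow>\<^sub>M prob_algebra ?N"
      unfolding K_def by (intro measurable_distr_prob_space2[where M="?N"] measurable_const) auto
    fix A assume A[measurable]: "A \<in> sets ?N"
    have "AE \<omega> in M. real_cond_exp M (sigma_gen M (X u)) (\<lambda>\<omega>. indicator A (S (X u \<omega>, W \<omega>))) \<omega>
        = (\<integral>\<omega>'. indicator A (S (X u \<omega>, W \<omega>')) \<partial>M)"
      by (rule real_cond_exp_sigma_gen_indep[OF Xu W ind[folded W_def]])
         (auto intro!: integrable_const_bound[of _ 1])
    moreover have "(\<integral>\<omega>'. indicator A (S (z, W \<omega>')) \<partial>M) = measure (K z) A" for z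
    proof -
      have "measure (K z) A = (\<integral>x. indicator A x \<partial>K z)"
        by (simp add: K)
      also have "\<dots> = (\<integral>\<omega>'. indicator A (S (z, W \<omega>')) \<partial>M)"
        unfolding K by (subst integral_distr) auto
      finally show ?thesis by simp
    qed
    moreover have "AE \<omega> in M. real_cond_exp M (sigma_gen M (X u)) (\<lambda>\<omega>. indicator A (S (X u \<omega>, W \<omega>))) \<omega>
        = real_cond_exp M (sigma_gen M (X u)) (indicator ((\<lambda>\<omega>. \<lambda>t\<in>I. X t \<omega>) -` A \<inter> space M)) \<omega>"
      by (intro sigma_finite_subalgebra.real_cond_exp_cong sigma_finite_subalgebra_sigma_gen Xu AE_I2)
         (auto simp: X_eq[symmetric] indicator_def)
    ultimately show "AE \<omega> in M. measure (K (X u \<omega>)) A =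
        real_cond_exp M (sigma_gen M (X u)) (indicator ((\<lambda>\<omega>. \<lambda>t\<in>I. X t \<omega>) -` A \<inter> space M)) \<omega>"
      by auto
  qed auto
  moreover have "gaussian_process (K z) I (\<lambda>t x. x t)" for z
    unfolding gaussian_process_def jointly_normal_def
  proof (intro conjI ballI allI impI)
    show "(\<lambda>x. x t) \<in> borel_measurable (K z)" if "t \<in> I" for t
      unfolding K using that by (simp add: measurable_component_singleton)
    fix J and c :: "'i \<Rightarrow> real ^ 'm" assume "finite J \<and> J \<subseteq> I"
    then have J: "finite J" "J \<subseteq> I" by auto
    \<comment> \<open>Under \<open>K z\<close>, a linear combination is distributed as a combination
      of values of \<open>X\<close>, with \<open>X u\<close> included, plus the constant
      \<open>d \<bullet> z\<close>. It is therefore normal for every \<open>z\<close>.\<close>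
    define d where "d = (\<Sum>j\<in>J. a j *\<^sub>R c j)"
    define c' where "c' j = (if j \<in> J then c j else 0) - (if j = u then d else 0)" for j
    have m[measurable]: "(\<lambda>x. \<Sum>j\<in>J. c j \<bullet> x j) \<in> borel_measurable ?N"
      using J by (intro borel_measurable_sum borel_measurable_inner borel_measurable_const
          measurable_component_singleton) auto
    have lin: "(\<Sum>j\<in>J. c j \<bullet> S (z, W \<omega>) j) = (\<Sum>j\<in>insert u J. c' j \<bullet> X j \<omega>) + d \<bullet> z" for \<omega>
    proof -
      have "(\<Sum>j\<in>J. c j \<bullet> S (z, W \<omega>) j) = (\<Sum>j\<in>J. c j \<bullet> (X j \<omega> - a j *\<^sub>R X u \<omega> + a j *\<^sub>R z))"
        using J by (intro sum.cong) (auto simp: S_def W_def)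
      also have "\<dots> = (\<Sum>j\<in>J. c j \<bullet> X j \<omega>) - d \<bullet> X u \<omega> + d \<bullet> z"
        by (simp add: d_def inner_add_right inner_diff_right sum.distrib sum_subtractf inner_sum_left)
      also have "(\<Sum>j\<in>J. c j \<bullet> X j \<omega>) = (\<Sum>j\<in>insert u J. (if j \<in> J then c j else 0) \<bullet> X j \<omega>)"
        using J by (intro sum.mono_neutral_cong_left) auto
      also have "d \<bullet> X u \<omega> = (\<Sum>j\<in>insert u J. (if j = u then d else 0) \<bullet> X j \<omega>)"
      proof -
        have "(\<Sum>j\<in>insert u J. (if j = u then d else 0) \<bullet> X j \<omega>) = (\<Sum>j\<in>{u}. d \<bullet> X j \<omega>)"
          using J by (intro sum.mono_neutral_cong_right) auto
        then show ?thesis by simp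
      qed
      finally show ?thesis by (simp add: c'_def inner_diff_left sum_subtractf)
    qed
    have J': "finite (insert u J)" "insert u J \<subseteq> I" using J u by auto
    obtain \<mu> \<sigma> where n: "\<sigma> \<ge> 0" "distr M borel (\<lambda>\<omega>. \<Sum>j\<in>insert u J. c' j \<bullet> X j \<omega>) = normal_law \<mu> \<sigma>"
      using gaussian_process_combination[OF G J'] by blast
    have "distr (K z) borel (\<lambda>x. \<Sum>j\<in>J. c j \<bullet> x j) = distr M borel (\<lambda>\<omega>. \<Sum>j\<in>J. c j \<bullet> S (z, W \<omega>) j)"
      unfolding K by (subst distr_distr) (auto simp: comp_def)
    also have "\<dots> = normal_law (\<mu> + d \<bullet> z) \<sigma>"
      unfolding lin
      by (rule distr_add_const_normal_law[OF n(2) n(1) gaussian_process_combination_measurable[OF G J']])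
    finally show "\<exists>\<mu> \<sigma>. 0 \<le> \<sigma> \<and> distr (K z) borel (\<lambda>\<omega>. \<Sum>j\<in>J. c j \<bullet> \<omega> j) = normal_law \<mu> \<sigma>"
      using n(1) by blast
  qed
  ultimately show ?thesis
    unfolding cond_gaussian_process_def by blast
qed

section \<open>Matrix entries and the theorem itself\<close>

lemma outer_prod_nth [simp]: "outer_prod x y $ i $ j = x $ i * y $ j"
  by (simp add: outer_prod_def matrix_matrix_mult_def columnvector_def rowvector_def)

lemma mat_1_diff_mult: "(mat 1 - c *\<^sub>R mat 1) ** A = (1 - c) *\<^sub>R A"
  for A :: "real ^ 'n ^ 'm"
  by (simp add: vec_eq_iff matrix_matrix_mult_def mat_def if_distrib[where f="\<lambda>x. _ * x"] algebra_simps
      if_distrib[where f="\<lambda>x. x * _"] sum_subtractf cong: if_cong)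

lemma mult_mat_1_diff: "A ** (mat 1 - c *\<^sub>R mat 1) = (1 - c) *\<^sub>R A"
  for A :: "real ^ 'n ^ 'm"
  by (simp add: vec_eq_iff matrix_matrix_mult_def mat_def if_distrib[where f="\<lambda>x. _ * x"] algebra_simps
      if_distrib[where f="\<lambda>x. x * _"] sum_subtractf cong: if_cong)

theorem lemma2:
  fixes M :: "'a measure"
    and X :: "real \<Rightarrow> 'a \<Rightarrow> real ^ 'm"
    and \<alpha> \<beta> :: "real ^ 'm ^ 'm"
    and T :: ereal
    and u :: real
  assumes "prob_space M"
    and "0 < T"
    and "transpose \<alpha> = \<alpha>" and "transpose \<beta> = \<beta>"
    and "gaussian_process M {t. 0 \<le> t \<and> ereal t < T} X"
    and "\<And>t. 0 \<le> t \<Longrightarrow> ereal t < T \<Longrightarrow> integral\<^sup>L M (X t) = 0"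
    and "\<And>t s. 0 \<le> t \<Longrightarrow> ereal t < T \<Longrightarrow> 0 \<le> s \<Longrightarrow> ereal s < T \<Longrightarrow>
           cov_kernel M X t s =
             (if s \<le> t then s *\<^sub>R (\<alpha> - t *\<^sub>R \<beta>) else t *\<^sub>R (\<alpha> - s *\<^sub>R \<beta>))"
    and "0 < u" and "ereal u < T"
  shows "cond_gaussian_process M {0..u} X (X u)
    \<and> (\<forall>t\<in>{0..u}. AE \<omega> in M.
          vec_cond_exp M (sigma_gen M (X u)) (X t) \<omega> = (t / u) *\<^sub>R X u \<omega>)
    \<and> (\<forall>t\<in>{0..u}. \<forall>s\<in>{0..u}. AE \<omega> in M.
          mat_cond_exp M (sigma_gen M (X u))
            (\<lambda>\<omega>. outer_prod (X t \<omega> - vec_cond_exp M (sigma_gen M (X u)) (X t) \<omega>)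
                             (X s \<omega> - vec_cond_exp M (sigma_gen M (X u)) (X s) \<omega>)) \<omega>
          = (if s \<le> t then (mat 1 - (t / u) *\<^sub>R mat 1) ** (s *\<^sub>R \<alpha>)
             else (t *\<^sub>R \<alpha>) ** (mat 1 - (s / u) *\<^sub>R mat 1)))"
proof -
  interpret prob_space M by fact
  note mean = assms(6) and cov = assms(7) and u_pos = \<open>0 < u\<close>
  let ?I = "{0..u}"
  let ?N = "Pi\<^sub>M ?I (\<lambda>_. borel :: (real ^ 'm) measure)"
  let ?F = "sigma_gen M (X u)"
  have I: "?I \<subseteq> {t. 0 \<le> t \<and> ereal t < T}"
    using \<open>ereal u < T\<close> by (auto intro: le_less_trans[of _ "ereal u"])
  then have T: "ereal t < T" if "0 \<le> t" "t \<le> u" for t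
    using that by auto
  have G: "gaussian_process M ?I X"
    using assms(5) I by (rule gaussian_process_mono)
  have u: "u \<in> ?I" using u_pos by simp
  note X[measurable] = gaussian_process_measurable[OF G]
  have Xu[measurable]: "X u \<in> borel_measurable M" using u by (rule X)
  note int1 = gaussian_process_nth_integrable[OF G]
  note int2 = gaussian_process_mult_integrable[OF G]
  \<comment> \<open>A Bochner integral may be 0 merely because the integrand is not integrable.
    Gaussianity provides integrability, so the integral can be taken in each coordinate.\<close>
  have mean: "expectation (\<lambda>\<omega>. X t \<omega> $ i) = 0" if "t \<in> ?I" for t i
    using integral_vec_nth[of M "X t" i] int1[OF that] mean[of t] that T by simp
  have second: "expectation (\<lambda>\<omega>. X t \<omega> $ i * X s \<omega> $ j) =
      (if s \<le> t then s * (\<alpha> $ i $ j - t * \<beta> $ i $ j) else t * (\<alpha> $ i $ j - s * \<beta> $ i $ j))"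
    if ts: "t \<in> ?I" "s \<in> ?I" for t s i j
  proof -
    have "expectation (\<lambda>\<omega>. X t \<omega> $ i * X s \<omega> $ j) = cov_kernel M X t s $ i $ j"
      unfolding cov_kernel_def using int2[OF ts]
      by (subst integral_vec_nth, intro integrable_vecI, simp, subst integral_vec_nth, simp_all)
    then show ?thesis using ts T cov[of t s] by simp
  qed
  define R where "R t \<omega> = X t \<omega> - (t / u) *\<^sub>R X u \<omega>" for t \<omega>
  have R[measurable]: "R t \<in> borel_measurable M" if "t \<in> ?I" for t
    unfolding R_def using that by measurable
  have intR1: "integrable M (\<lambda>\<omega>. R t \<omega> $ i)" if "t \<in> ?I" for t i
    using int1[OF that] int1[OF u] by (simp add: R_def)
  have meanR: "expectation (\<lambda>\<omega>. R t \<omega> $ i) = 0" if "t \<in> ?I" for t i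
    using int1[OF that] int1[OF u] mean[OF that] mean[OF u] by (simp add: R_def)
  have uR_eq: "(\<lambda>\<omega>. X u \<omega> $ i * R t \<omega> $ j)
      = (\<lambda>\<omega>. X u \<omega> $ i * X t \<omega> $ j - (t / u) * (X u \<omega> $ i * X u \<omega> $ j))" for t i j
    by (auto simp: R_def algebra_simps)
  have uncorr: "expectation (\<lambda>\<omega>. X u \<omega> $ i * R t \<omega> $ j) = 0" if t: "t \<in> ?I" for t i j
  proof -
    have "expectation (\<lambda>\<omega>. X u \<omega> $ i * R t \<omega> $ j) =
        expectation (\<lambda>\<omega>. X u \<omega> $ i * X t \<omega> $ j) - (t / u) * expectation (\<lambda>\<omega>. X u \<omega> $ i * X u \<omega> $ j)"
      unfolding uR_eq using int2[OF u t] int2[OF u u] by simp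
    then show ?thesis
      using t u_pos by (simp add: second)
  qed
  \<comment> \<open>Only in \<open>X t\<close> times \<open>R s\<close> is the residual
    \<open>R s\<close> expanded; the other term keeps the product of \<open>X u\<close> and
    \<open>R s\<close>, whose expectation vanishes by \<open>uncorr\<close>.\<close>
  have prod_eq: "(\<lambda>\<omega>. R t \<omega> $ i * R s \<omega> $ j) = (\<lambda>\<omega>. X t \<omega> $ i * X s \<omega> $ j
      - (s / u) * (X t \<omega> $ i * X u \<omega> $ j) - (t / u) * (X u \<omega> $ i * R s \<omega> $ j))" for t s i j
    by (auto simp: R_def algebra_simps)
  have intuR: "integrable M (\<lambda>\<omega>. X u \<omega> $ i * R s \<omega> $ j)" if "s \<in> ?I" for s i j
    unfolding uR_eq using int2[OF u that] int2[OF u u] by simp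
  have intR2: "integrable M (\<lambda>\<omega>. R t \<omega> $ i * R s \<omega> $ j)" if "t \<in> ?I" "s \<in> ?I" for t s i j
    unfolding prod_eq using int2[OF that] int2[OF that(1) u] intuR[OF that(2)] by simp
  have covR: "expectation (\<lambda>\<omega>. R t \<omega> $ i * R s \<omega> $ j)
      = (if s \<le> t then (1 - t / u) * s else (1 - s / u) * t) * \<alpha> $ i $ j"
    if ts: "t \<in> ?I" "s \<in> ?I" for t s i j
  proof -
    have "expectation (\<lambda>\<omega>. R t \<omega> $ i * R s \<omega> $ j)
        = expectation (\<lambda>\<omega>. X t \<omega> $ i * X s \<omega> $ j) - (s / u) * expectation (\<lambda>\<omega>. X t \<omega> $ i * X u \<omega> $ j)"
      unfolding prod_eq using int2[OF ts] int2[OF ts(1) u] intuR[OF ts(2)] uncorr[OF ts(2)] by simp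
    also have "\<dots> = (if s \<le> t then (1 - t / u) * s else (1 - s / u) * t) * \<alpha> $ i $ j"
      unfolding second[OF ts] second[OF ts(1) u] using ts u_pos by (auto simp: field_simps)
    finally show ?thesis .
  qed
  define W where "W \<omega> = (\<lambda>t\<in>?I. R t \<omega>)" for \<omega>
  have W[measurable]: "W \<in> M \<rightarrow>\<^sub>M ?N"
    unfolding W_def by (intro measurable_restrict R)
  have ind: "distr M (borel \<Otimes>\<^sub>M ?N) (\<lambda>\<omega>. (X u \<omega>, W \<omega>)) = distr M borel (X u) \<Otimes>\<^sub>M distr M ?N W"
    unfolding W_def R_def
    by (rule gaussian_process_residual_indep[OF G u _ mean]) (use uncorr u_pos in \<open>simp_all add: R_def\<close>)
  have "cond_gaussian_process M ?I X (X u)"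
    using cond_gaussian_process_of_indep[OF G u ind[unfolded W_def R_def]] .
  moreover have cexp: "AE \<omega> in M. vec_cond_exp M ?F (X t) \<omega> = (t / u) *\<^sub>R X u \<omega>" if t: "t \<in> ?I" for t
  proof -
    have "AE \<omega> in M. real_cond_exp M ?F (\<lambda>\<omega>. X t \<omega> $ i) \<omega> = (t / u) * X u \<omega> $ i" for i
    proof -
      \<comment> \<open>Here \<open>X t\<close> is recovered from \<open>X u\<close> and the
        residual. Freezing \<open>X u\<close> leaves the mean of \<open>R t\<close>, which is 0,
        plus the multiple \<open>t / u\<close> of \<open>X u\<close>.\<close>
      let ?f = "\<lambda>p :: (real ^ 'm) \<times> (real \<Rightarrow> real ^ 'm). snd p t $ i + (t / u) * fst p $ i"
      have f: "?f (X u \<omega>, W \<omega>') = R t \<omega>' $ i + (t / u) * X u \<omega> $ i" for \<omega> \<omega>'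
        using t by (simp add: W_def)
      have f': "?f (X u \<omega>, W \<omega>) = X t \<omega> $ i" for \<omega>
        unfolding f by (simp add: R_def)
      have "(\<lambda>w. w t) \<in> ?N \<rightarrow>\<^sub>M borel"
        using t by (rule measurable_component_singleton)
      then have "?f \<in> borel_measurable (borel \<Otimes>\<^sub>M ?N)" by measurable
      moreover have "integrable M (\<lambda>\<omega>. ?f (X u \<omega>, W \<omega>))"
        unfolding f' using t by (rule int1)
      ultimately have "AE \<omega> in M. real_cond_exp M ?F (\<lambda>\<omega>. ?f (X u \<omega>, W \<omega>)) \<omega> = (\<integral>\<omega>'. ?f (X u \<omega>, W \<omega>') \<partial>M)"
        by (rule real_cond_exp_sigma_gen_indep[OF Xu W ind])
      then show ?thesis
        unfolding f' unfolding f using intR1[OF t] meanR[OF t] by (simp add: prob_space)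
    qed
    then have "AE \<omega> in M. \<forall>i. real_cond_exp M ?F (\<lambda>\<omega>. X t \<omega> $ i) \<omega> = (t / u) * X u \<omega> $ i"
      by (simp add: AE_all_countable)
    then show ?thesis
      by eventually_elim (simp add: vec_cond_exp_def vec_eq_iff)
  qed
  moreover have "AE \<omega> in M. mat_cond_exp M ?F
        (\<lambda>\<omega>. outer_prod (X t \<omega> - vec_cond_exp M ?F (X t) \<omega>) (X s \<omega> - vec_cond_exp M ?F (X s) \<omega>)) \<omega>
      = (if s \<le> t then (mat 1 - (t / u) *\<^sub>R mat 1) ** (s *\<^sub>R \<alpha>)
         else (t *\<^sub>R \<alpha>) ** (mat 1 - (s / u) *\<^sub>R mat 1))" if t: "t \<in> ?I" and s: "s \<in> ?I" for t s
  proof -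
    let ?E = "\<lambda>t \<omega>. X t \<omega> - vec_cond_exp M ?F (X t) \<omega>"
    have mE: "?E t \<in> borel_measurable M" if "t \<in> ?I" for t
      using that unfolding vec_cond_exp_def
      by (intro borel_measurable_diff X borel_measurable_vec_lambda borel_measurable_cond_exp2)
    have "AE \<omega> in M. real_cond_exp M ?F (\<lambda>\<omega>. outer_prod (?E t \<omega>) (?E s \<omega>) $ i $ j) \<omega>
        = (if s \<le> t then (1 - t / u) * s else (1 - s / u) * t) * \<alpha> $ i $ j" for i j
    proof -
      let ?f = "\<lambda>p :: (real ^ 'm) \<times> (real \<Rightarrow> real ^ 'm). snd p t $ i * snd p s $ j"
      have f: "?f (X u \<omega>, W \<omega>') = R t \<omega>' $ i * R s \<omega>' $ j" for \<omega> \<omega>'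
        using t s by (simp add: W_def)
      have "(\<lambda>w. w t) \<in> ?N \<rightarrow>\<^sub>M borel" "(\<lambda>w. w s) \<in> ?N \<rightarrow>\<^sub>M borel"
        by (rule measurable_component_singleton[OF t], rule measurable_component_singleton[OF s])
      then have "?f \<in> borel_measurable (borel \<Otimes>\<^sub>M ?N)" by measurable
      moreover have "integrable M (\<lambda>\<omega>. ?f (X u \<omega>, W \<omega>))"
        unfolding f using t s by (rule intR2)
      ultimately have "AE \<omega> in M. real_cond_exp M ?F (\<lambda>\<omega>. ?f (X u \<omega>, W \<omega>)) \<omega> = (\<integral>\<omega>'. ?f (X u \<omega>, W \<omega>') \<partial>M)"
        by (rule real_cond_exp_sigma_gen_indep[OF Xu W ind])
      \<comment> \<open>The conditional mean is known only almost surely, so the centred variables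
        are replaced by residuals under the conditional expectation. The residuals are independent
        of \<open>X u\<close>, which makes the conditional covariance the constant computed in
        \<open>covR\<close>.\<close>
      moreover have "AE \<omega> in M. real_cond_exp M ?F (\<lambda>\<omega>. outer_prod (?E t \<omega>) (?E s \<omega>) $ i $ j) \<omega>
          = real_cond_exp M ?F (\<lambda>\<omega>. R t \<omega> $ i * R s \<omega> $ j) \<omega>"
      proof (rule sigma_finite_subalgebra.real_cond_exp_cong[OF sigma_finite_subalgebra_sigma_gen[OF Xu]])
        show "AE \<omega> in M. outer_prod (?E t \<omega>) (?E s \<omega>) $ i $ j = R t \<omega> $ i * R s \<omega> $ j"
          using cexp[OF t] cexp[OF s] by eventually_elim (simp add: R_def)
        show "(\<lambda>\<omega>. outer_prod (?E t \<omega>) (?E s \<omega>) $ i $ j) \<in> borel_measurable M"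
          unfolding outer_prod_nth
          by (intro borel_measurable_times borel_measurable_vec_nth mE t s)
        show "(\<lambda>\<omega>. R t \<omega> $ i * R s \<omega> $ j) \<in> borel_measurable M"
          by (intro borel_measurable_times borel_measurable_vec_nth R t s)
      qed
      ultimately show ?thesis
        unfolding f covR[OF t s] by eventually_elim simp
    qed
    then have "AE \<omega> in M. \<forall>i j. real_cond_exp M ?F (\<lambda>\<omega>. outer_prod (?E t \<omega>) (?E s \<omega>) $ i $ j) \<omega>
        = (if s \<le> t then (1 - t / u) * s else (1 - s / u) * t) * \<alpha> $ i $ j"
      by (simp only: AE_all_countable) blast
    then show ?thesis
    proof eventually_elim
      case (elim \<omega>)
      then show ?case
        by (simp only: mat_cond_exp_def vec_eq_iff vec_lambda_beta mat_1_diff_mult mult_mat_1_diff) simp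
    qed
  qed
  ultimately show ?thesis by blast
qed

end
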